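(* Let $J$ be a WOT-closed two-sided ideal of $F_n^\infty$ such that $1\in\mathcal N_J$. Two constrained shifts (associated with $J$) are similar if and only if they are unitarily equivalent.
   Context: Let $n\in\{1,2,\dots\}$ and let $F^2(H_n)=\bigoplus_{k\ge 0}H_n^{\otimes k}$ be the full Fock space of an $n$-dimensional complex Hilbert space $H_n$ with orthonormal basis $e_1,\dots,e_n$ (with $H_n^{\otimes 0}=\mathbb C1$). The left creation operators are $S_i\varphi=e_i\otimes\varphi$. $F_n^\infty\subset B(F^2(H_n))$ is the WOT-closed algebra generated by $S_1,\dots,S_n$ and the identity. For a WOT-closed two-sided ideal $J$ of $F_n^\infty$, put $\mathcal N_J=F^2(H_n)\ominus\overline{JF^2(H_n)}$ and $B_i=P_{\mathcal N_J}S_i|_{\mathcal N_J}$. For a Hilbert space $\mathcal H$, the $n$-tuple $[B_1\otimes I_{\mathcal H},\ldots,B_n\otimes I_{\mathcal H}]$ on $\mathcal N_J\otimes\mathcal H$ (or any $n$-tuple unitarily equivalent to it) is called a constrained shift, of multiplicity $\dim\mathcal H$. Two $n$-tuples $[V_1,\dots,V_n]$ on $\mathcal K$ and $[V_1',\dots,V_n']$ on $\mathcal K'$ are similar (resp. unitarily equivalent) if there is a bounded invertible (resp. unitary) operator $X:\mathcal K\to\mathcal K'$ with $XV_i=V_i'X$ for all $i=1,\dots,n$. *)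

theory Defs
  imports "HOL-Analysis.Analysis"
begin

section \<open>Complex Hilbert spaces\<close>

text \<open>
  The complex inner product is linear in its first argument. The real inner product of
  \<^class>\<open>real_inner\<close> is its real part, so that norm, topology and completeness are those of
  the underlying real Hilbert space.
\<close>

class chilbert_space = real_inner + complete_space +
  fixes scaleC :: "complex \<Rightarrow> 'a \<Rightarrow> 'a" (infixr "*\<^sub>C" 75)
    and cinner :: "'a \<Rightarrow> 'a \<Rightarrow> complex"
  assumes scaleC_of_real: "of_real r *\<^sub>C x = r *\<^sub>R x"
    and scaleC_add_right: "a *\<^sub>C (x + y) = a *\<^sub>C x + a *\<^sub>C y"
    and scaleC_add_left: "(a + b) *\<^sub>C x = a *\<^sub>C x + b *\<^sub>C x"
    and scaleC_scaleC: "a *\<^sub>C (b *\<^sub>C x) = (a * b) *\<^sub>C x"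
    and cinner_commute: "cinner x y = cnj (cinner y x)"
    and cinner_add_left: "cinner (x + y) z = cinner x z + cinner y z"
    and cinner_scaleC_left: "cinner (a *\<^sub>C x) y = a * cinner x y"
    and inner_eq_Re_cinner: "inner x y = Re (cinner x y)"

subclass (in chilbert_space) banach ..

lemma scaleC_one [simp]: "1 *\<^sub>C x = (x::'a::chilbert_space)"
  using scaleC_of_real[of 1 x] by simp

global_interpretation complex_vector: vector_space "scaleC :: complex \<Rightarrow> 'a \<Rightarrow> 'a::chilbert_space"
  by standard (simp_all add: scaleC_add_right scaleC_add_left scaleC_scaleC)

abbreviation csubspace :: "'a::chilbert_space set \<Rightarrow> bool" where
  "csubspace \<equiv> complex_vector.subspace"

abbreviation cspan :: "'a::chilbert_space set \<Rightarrow> 'a set" where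
  "cspan \<equiv> complex_vector.span"

lemma cinner_zero_left [simp]: "cinner 0 (x::'a::chilbert_space) = 0"
  using cinner_add_left[of 0 0 x] by simp

lemma cinner_zero_right [simp]: "cinner (x::'a::chilbert_space) 0 = 0"
  by (metis cinner_commute cinner_zero_left complex_cnj_zero)

lemma cinner_add_right: "cinner (x::'a::chilbert_space) (y + z) = cinner x y + cinner x z"
  by (metis cinner_commute cinner_add_left complex_cnj_add)

lemma cinner_scaleC_right: "cinner (x::'a::chilbert_space) (a *\<^sub>C y) = cnj a * cinner x y"
  by (metis cinner_commute cinner_scaleC_left complex_cnj_mult)

lemma cinner_minus_left: "cinner (- x) (y::'a::chilbert_space) = - cinner x y"
  using cinner_add_left[of x "- x" y] by (simp add: eq_neg_iff_add_eq_0 add.commute)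

lemma cinner_minus_right: "cinner x (- y::'a::chilbert_space) = - cinner x y"
  by (metis cinner_commute cinner_minus_left complex_cnj_minus)

lemma cinner_diff_left: "cinner (x - y) (z::'a::chilbert_space) = cinner x z - cinner y z"
  using cinner_add_left[of x "- y" z] by (simp add: cinner_minus_left)

lemma cinner_diff_right: "cinner x (y - z::'a::chilbert_space) = cinner x y - cinner x z"
  using cinner_add_right[of x y "- z"] by (simp add: cinner_minus_right)

lemma cinner_self: "cinner x x = of_real ((norm (x::'a::chilbert_space))\<^sup>2)"
proof -
  have "Im (cinner x x) = 0"
    by (metis cinner_commute cnj.simps(2) equal_neg_zero)
  moreover have "Re (cinner x x) = (norm x)\<^sup>2"
    by (simp add: inner_eq_Re_cinner[symmetric] power2_norm_eq_inner)
  ultimately show ?thesis by (simp add: complex_eq_iff)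
qed

lemma norm_scaleC: "norm (a *\<^sub>C (x::'a::chilbert_space)) = cmod a * norm x"
proof -
  have "cinner (a *\<^sub>C x) (a *\<^sub>C x) = (a * cnj a) * cinner x x"
    by (simp add: cinner_scaleC_left cinner_scaleC_right)
  then have "of_real ((norm (a *\<^sub>C x))\<^sup>2) = (of_real ((cmod a * norm x)\<^sup>2) :: complex)"
    by (simp only: cinner_self complex_norm_square[symmetric] power_mult_distrib of_real_mult of_real_power)
  then have "(norm (a *\<^sub>C x))\<^sup>2 = (cmod a * norm x)\<^sup>2"
    by (simp only: of_real_eq_iff)
  then show ?thesis by (simp add: power2_eq_iff_nonneg)
qed

lemma norm_cinner_le: "cmod (cinner x y) \<le> norm x * norm (y::'a::chilbert_space)"
proof (cases "cinner x y = 0")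
  case False
  define u where "u = cnj (cinner x y) / of_real (cmod (cinner x y))"
  have u: "cmod u = 1" using False by (simp add: u_def norm_divide)
  have "u * cinner x y = of_real (cmod (cinner x y))"
    using False
    by (simp add: u_def field_simps complex_norm_square[symmetric] power2_eq_square)
  then have "cmod (cinner x y) = inner (u *\<^sub>C x) y"
    by (simp add: inner_eq_Re_cinner cinner_scaleC_left)
  also have "\<dots> \<le> norm (u *\<^sub>C x) * norm y" by (rule norm_cauchy_schwarz)
  finally show ?thesis by (simp add: norm_scaleC u)
qed simp

instantiation complex :: chilbert_space
begin
definition scaleC_complex :: "complex \<Rightarrow> complex \<Rightarrow> complex" where "scaleC_complex = (*)"
definition cinner_complex :: "complex \<Rightarrow> complex \<Rightarrow> complex" where "cinner_complex x y = x * cnj y"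
instance
  by standard
     (auto simp: scaleC_complex_def cinner_complex_def inner_complex_def algebra_simps scaleR_conv_of_real)
end


section \<open>The Hilbert space of square-summable families\<close>

typedef (overloaded) ('i, 'a) ell2 =
  "{f :: 'i \<Rightarrow> 'a::chilbert_space. (\<lambda>i. (norm (f i))\<^sup>2) summable_on UNIV}"
  morphisms ell2_apply Abs_ell2
  by (rule exI[of _ "\<lambda>_. 0"]) simp

lemma ell2_summable: "(\<lambda>i. (norm (ell2_apply f i))\<^sup>2) summable_on UNIV"
  using ell2_apply[of f] by simp

lemma ell2_eqI: "(\<And>i. ell2_apply f i = ell2_apply g i) \<Longrightarrow> f = g"
  by (metis ell2_apply_inject ext)

lemma square_summable_add:
  fixes f g :: "'i \<Rightarrow> 'a::chilbert_space"
  assumes "(\<lambda>i. (norm (f i))\<^sup>2) summable_on UNIV" "(\<lambda>i. (norm (g i))\<^sup>2) summable_on UNIV"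
  shows "(\<lambda>i. (norm (f i + g i))\<^sup>2) summable_on UNIV"
proof (rule summable_on_comparison_test)
  show "(\<lambda>i. 2 * (norm (f i))\<^sup>2 + 2 * (norm (g i))\<^sup>2) summable_on UNIV"
    by (intro summable_on_add summable_on_cmult_right assms)
  show "(norm (f i + g i))\<^sup>2 \<le> 2 * (norm (f i))\<^sup>2 + 2 * (norm (g i))\<^sup>2" for i
  proof -
    have "(norm (f i + g i))\<^sup>2 \<le> (norm (f i) + norm (g i))\<^sup>2"
      by (intro power_mono norm_triangle_ineq) simp
    also have "\<dots> \<le> 2 * (norm (f i))\<^sup>2 + 2 * (norm (g i))\<^sup>2"
      using sum_squares_bound[of "norm (f i)" "norm (g i)"] by (simp add: power2_sum)
    finally show ?thesis .
  qed
qed simp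

lemma square_summable_scaleC:
  fixes f :: "'i \<Rightarrow> 'a::chilbert_space"
  assumes "(\<lambda>i. (norm (f i))\<^sup>2) summable_on UNIV"
  shows "(\<lambda>i. (norm (c *\<^sub>C f i))\<^sup>2) summable_on UNIV"
  by (simp add: norm_scaleC power_mult_distrib summable_on_cmult_right assms)

lemma summable_cinner:
  fixes f g :: "'i \<Rightarrow> 'a::chilbert_space"
  assumes "(\<lambda>i. (norm (f i))\<^sup>2) summable_on UNIV" "(\<lambda>i. (norm (g i))\<^sup>2) summable_on UNIV"
  shows "(\<lambda>i. cinner (f i) (g i)) summable_on UNIV"
proof (rule abs_summable_summable, rule summable_on_comparison_test)
  show "(\<lambda>i. (norm (f i))\<^sup>2 + (norm (g i))\<^sup>2) summable_on UNIV"
    by (intro summable_on_add assms)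
  show "norm (cinner (f i) (g i)) \<le> (norm (f i))\<^sup>2 + (norm (g i))\<^sup>2" for i
  proof -
    have "norm (cinner (f i) (g i)) \<le> norm (f i) * norm (g i)" by (rule norm_cinner_le)
    also have "\<dots> \<le> 2 * (norm (f i) * norm (g i))" by simp
    also have "\<dots> \<le> (norm (f i))\<^sup>2 + (norm (g i))\<^sup>2"
      using sum_squares_bound[of "norm (f i)" "norm (g i)"] by (simp add: algebra_simps)
    finally show ?thesis .
  qed
qed simp

instantiation ell2 :: (type, chilbert_space) real_inner
begin

definition "(0::('a,'b) ell2) = Abs_ell2 (\<lambda>_. 0)"
definition "(f::('a,'b) ell2) + g = Abs_ell2 (\<lambda>i. ell2_apply f i + ell2_apply g i)"
definition "- (f::('a,'b) ell2) = Abs_ell2 (\<lambda>i. - ell2_apply f i)"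
definition "(f::('a,'b) ell2) - g = Abs_ell2 (\<lambda>i. ell2_apply f i - ell2_apply g i)"
definition "r *\<^sub>R (f::('a,'b) ell2) = Abs_ell2 (\<lambda>i. r *\<^sub>R ell2_apply f i)"
definition "inner (f::('a,'b) ell2) g = (\<Sum>\<^sub>\<infinity>i. inner (ell2_apply f i) (ell2_apply g i))"
definition "norm (f::('a,'b) ell2) = sqrt (inner f f)"
definition "dist (f::('a,'b) ell2) g = norm (f - g)"
definition "sgn (f::('a,'b) ell2) = inverse (norm f) *\<^sub>R f"
definition "(uniformity :: (('a,'b) ell2 \<times> ('a,'b) ell2) filter)
  = (INF e\<in>{0 <..}. principal {(x, y). dist x y < e})"
definition "open (U :: ('a,'b) ell2 set) \<longleftrightarrow>
  (\<forall>x\<in>U. eventually (\<lambda>(x', y). x' = x \<longrightarrow> y \<in> U) uniformity)"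

lemma ell2_apply_zero [simp]: "ell2_apply (0::('a,'b) ell2) i = 0"
  by (simp add: zero_ell2_def Abs_ell2_inverse)

lemma ell2_apply_add [simp]:
  "ell2_apply (f + g :: ('a,'b) ell2) i = ell2_apply f i + ell2_apply g i"
  by (simp add: plus_ell2_def Abs_ell2_inverse square_summable_add ell2_summable)

lemma ell2_apply_uminus [simp]: "ell2_apply (- f :: ('a,'b) ell2) i = - ell2_apply f i"
  by (simp add: uminus_ell2_def Abs_ell2_inverse ell2_summable)

lemma ell2_apply_diff [simp]:
  "ell2_apply (f - g :: ('a,'b) ell2) i = ell2_apply f i - ell2_apply g i"
  using square_summable_add[of "ell2_apply f" "\<lambda>i. - ell2_apply g i"]
  by (simp add: minus_ell2_def Abs_ell2_inverse ell2_summable)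

lemma ell2_apply_scaleR [simp]: "ell2_apply (r *\<^sub>R f :: ('a,'b) ell2) i = r *\<^sub>R ell2_apply f i"
  using square_summable_scaleC[of "ell2_apply f" "of_real r"]
  by (simp add: scaleR_ell2_def Abs_ell2_inverse ell2_summable scaleC_of_real)

lemma ell2_inner_summable:
  "(\<lambda>i. inner (ell2_apply (f::('a,'b) ell2) i) (ell2_apply g i)) summable_on UNIV"
  unfolding inner_eq_Re_cinner
  by (intro summable_on_Re summable_cinner ell2_summable)

instance
proof
  fix f g h :: "('a,'b) ell2" and r s :: real
  show "f + g + h = f + (g + h)" by (rule ell2_eqI) (simp add: add.assoc)
  show "f + g = g + f" by (rule ell2_eqI) (simp add: add.commute)
  show "0 + f = f" by (rule ell2_eqI) simp
  show "- f + f = 0" by (rule ell2_eqI) simp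
  show "f - g = f + - g" by (rule ell2_eqI) simp
  show "r *\<^sub>R (f + g) = r *\<^sub>R f + r *\<^sub>R g" by (rule ell2_eqI) (simp add: scaleR_add_right)
  show "(r + s) *\<^sub>R f = r *\<^sub>R f + s *\<^sub>R f" by (rule ell2_eqI) (simp add: scaleR_add_left)
  show "r *\<^sub>R s *\<^sub>R f = (r * s) *\<^sub>R f" by (rule ell2_eqI) simp
  show "1 *\<^sub>R f = f" by (rule ell2_eqI) simp
  show "inner f g = inner g f" by (simp add: inner_ell2_def inner_commute)
  show "inner (f + g) h = inner f h + inner g h"
    by (simp add: inner_ell2_def inner_add_left infsum_add ell2_inner_summable)
  show "inner (r *\<^sub>R f) g = r * inner f g"
    by (simp add: inner_ell2_def infsum_cmult_right' )
  show "0 \<le> inner f f" by (simp add: inner_ell2_def infsum_nonneg)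
  show "inner f f = 0 \<longleftrightarrow> f = 0"
  proof
    assume *: "inner f f = 0"
    have "inner (ell2_apply f i) (ell2_apply f i) = 0" for i
      by (rule nonneg_infsum_le_0D[where A = UNIV and f = "\<lambda>i. inner (ell2_apply f i) (ell2_apply f i)"])
         (use * ell2_inner_summable[of f f] in \<open>auto simp: inner_ell2_def\<close>)
    then show "f = 0" by (intro ell2_eqI) simp
  qed (simp add: inner_ell2_def)
  show "norm f = sqrt (inner f f)" by (rule norm_ell2_def)
  show "dist f g = norm (f - g)" by (rule dist_ell2_def)
  show "sgn f = inverse (norm f) *\<^sub>R f" by (rule sgn_ell2_def)
  show "(uniformity :: (('a,'b) ell2 \<times> ('a,'b) ell2) filter)
    = (INF e\<in>{0 <..}. principal {(x, y). dist x y < e})" by (rule uniformity_ell2_def)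
  show "open U \<longleftrightarrow> (\<forall>x\<in>U. eventually (\<lambda>(x', y). x' = x \<longrightarrow> y \<in> U) uniformity)"
    for U :: "('a,'b) ell2 set" by (rule open_ell2_def)
qed

end

lemma norm_ell2_square: "(norm f)\<^sup>2 = (\<Sum>\<^sub>\<infinity>i. (norm (ell2_apply f i))\<^sup>2)"
  by (simp add: power2_norm_eq_inner inner_ell2_def)

lemma sum_le_norm_ell2:
  assumes "finite F" shows "(\<Sum>i\<in>F. (norm (ell2_apply f i))\<^sup>2) \<le> (norm f)\<^sup>2"
  unfolding norm_ell2_square
  by (rule finite_sum_le_infsum) (auto simp: ell2_summable assms)

lemma norm_ell2_apply_le: "norm (ell2_apply f i) \<le> norm f"
  using sum_le_norm_ell2[of "{i}" f] by (simp add: power2_le_iff_abs_le)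

lemma ell2_boundedI:
  fixes f :: "'i \<Rightarrow> 'a::chilbert_space"
  assumes "\<And>F. finite F \<Longrightarrow> (\<Sum>i\<in>F. (norm (f i))\<^sup>2) \<le> C\<^sup>2" and "0 \<le> C"
  shows "(\<lambda>i. (norm (f i))\<^sup>2) summable_on UNIV" and "norm (Abs_ell2 f) \<le> C"
proof -
  show *: "(\<lambda>i. (norm (f i))\<^sup>2) summable_on UNIV"
    by (rule nonneg_bdd_above_summable_on) (auto intro!: bdd_aboveI2[where M = "C\<^sup>2"] assms(1))
  have "(norm (Abs_ell2 f))\<^sup>2 \<le> C\<^sup>2"
    using infsum_le_finite_sums[OF * assms(1)]
    by (simp only: norm_ell2_square Abs_ell2_inverse[OF CollectI, OF *] subset_UNIV)
  then show "norm (Abs_ell2 f) \<le> C"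
    using assms(2) by (rule power2_le_imp_le)
qed

instance ell2 :: (type, chilbert_space) complete_space
proof
  fix X :: "nat \<Rightarrow> ('a, 'b) ell2"
  assume X: "Cauchy X"
  have "Cauchy (\<lambda>n. ell2_apply (X n) i)" for i
  proof (rule CauchyI)
    fix e :: real assume "0 < e"
    then obtain M where M: "\<forall>m\<ge>M. \<forall>n\<ge>M. norm (X m - X n) < e" using CauchyD[OF X] by blast
    have "norm (ell2_apply (X m) i - ell2_apply (X n) i) < e" if "m \<ge> M" "n \<ge> M" for m n
    proof -
      have "norm (ell2_apply (X m) i - ell2_apply (X n) i) \<le> norm (X m - X n)"
        using norm_ell2_apply_le[of "X m - X n" i] by simp
      also have "\<dots> < e" using M that by blast
      finally show ?thesis .
    qed
    then show "\<exists>M. \<forall>m\<ge>M. \<forall>n\<ge>M. norm (ell2_apply (X m) i - ell2_apply (X n) i) < e"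
      by (intro exI[of _ M]) simp
  qed
  then have "\<forall>i. \<exists>l. (\<lambda>n. ell2_apply (X n) i) \<longlonglongrightarrow> l"
    using Cauchy_convergent convergent_def by blast
  then obtain L where L: "\<And>i. (\<lambda>n. ell2_apply (X n) i) \<longlonglongrightarrow> L i"
    by (auto dest!: choice)
  have key: "\<exists>M. \<forall>m\<ge>M. (\<lambda>i. (norm (ell2_apply (X m) i - L i))\<^sup>2) summable_on UNIV
      \<and> norm (Abs_ell2 (\<lambda>i. ell2_apply (X m) i - L i)) \<le> e" if e: "0 < e" for e
  proof -
    obtain M where M: "\<forall>m\<ge>M. \<forall>n\<ge>M. norm (X m - X n) < e" using CauchyD[OF X e] by blast
    have bd: "(\<Sum>i\<in>F. (norm (ell2_apply (X m) i - L i))\<^sup>2) \<le> e\<^sup>2" if "finite F" "m \<ge> M" for F m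
    proof (rule LIMSEQ_le_const2)
      show "(\<lambda>n. \<Sum>i\<in>F. (norm (ell2_apply (X m) i - ell2_apply (X n) i))\<^sup>2)
          \<longlonglongrightarrow> (\<Sum>i\<in>F. (norm (ell2_apply (X m) i - L i))\<^sup>2)"
        by (intro tendsto_intros L)
      have "(\<Sum>i\<in>F. (norm (ell2_apply (X m) i - ell2_apply (X n) i))\<^sup>2) \<le> e\<^sup>2" if "n \<ge> M" for n
      proof -
        have "(\<Sum>i\<in>F. (norm (ell2_apply (X m) i - ell2_apply (X n) i))\<^sup>2) \<le> (norm (X m - X n))\<^sup>2"
          using sum_le_norm_ell2[OF \<open>finite F\<close>, of "X m - X n"] by simp
        also have "\<dots> \<le> e\<^sup>2" using M that \<open>m \<ge> M\<close> by (intro power_mono) (auto intro: less_imp_le)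
        finally show ?thesis .
      qed
      then show "\<exists>N. \<forall>n\<ge>N. (\<Sum>i\<in>F. (norm (ell2_apply (X m) i - ell2_apply (X n) i))\<^sup>2) \<le> e\<^sup>2"
        by blast
    qed
    show ?thesis using ell2_boundedI[OF bd] e by (meson less_imp_le)
  qed
  obtain M where M: "(\<lambda>i. (norm (ell2_apply (X M) i - L i))\<^sup>2) summable_on UNIV"
    using key[of 1] by auto
  have L2: "(\<lambda>i. (norm (L i))\<^sup>2) summable_on UNIV"
    using square_summable_add[OF ell2_summable[of "X M"], of "\<lambda>i. L i - ell2_apply (X M) i"] M
    by (simp add: norm_minus_commute)
  have diff: "X m - Abs_ell2 L = Abs_ell2 (\<lambda>i. ell2_apply (X m) i - L i)" for m
    by (simp add: minus_ell2_def Abs_ell2_inverse L2)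
  have "X \<longlonglongrightarrow> Abs_ell2 L"
  proof (rule LIMSEQ_I)
    fix r :: real assume "0 < r"
    then obtain M where "\<forall>m\<ge>M. norm (X m - Abs_ell2 L) \<le> r / 2"
      using key[of "r / 2"] unfolding diff by auto
    then show "\<exists>no. \<forall>n\<ge>no. norm (X n - Abs_ell2 L) < r"
      using \<open>0 < r\<close> by (intro exI[of _ M] allI impI) (rule le_less_trans[of _ "r / 2"], auto)
  qed
  then show "convergent X" by (rule convergentI)
qed

instantiation ell2 :: (type, chilbert_space) chilbert_space
begin

definition "c *\<^sub>C (f::('a,'b) ell2) = Abs_ell2 (\<lambda>i. c *\<^sub>C ell2_apply f i)"
definition "cinner (f::('a,'b) ell2) g = (\<Sum>\<^sub>\<infinity>i. cinner (ell2_apply f i) (ell2_apply g i))"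

lemma ell2_apply_scaleC [simp]: "ell2_apply (c *\<^sub>C f :: ('a,'b) ell2) i = c *\<^sub>C ell2_apply f i"
  by (simp add: scaleC_ell2_def Abs_ell2_inverse square_summable_scaleC ell2_summable)

instance
proof
  fix f g h :: "('a,'b) ell2" and a b :: complex and r :: real
  have [simp]: "(\<lambda>i. cinner (ell2_apply f i) (ell2_apply g i)) summable_on UNIV"
    for f g :: "('a,'b) ell2" by (intro summable_cinner ell2_summable)
  show "of_real r *\<^sub>C f = r *\<^sub>R f" by (rule ell2_eqI) (simp add: scaleC_of_real)
  show "a *\<^sub>C (f + g) = a *\<^sub>C f + a *\<^sub>C g" by (rule ell2_eqI) (simp add: scaleC_add_right)
  show "(a + b) *\<^sub>C f = a *\<^sub>C f + b *\<^sub>C f" by (rule ell2_eqI) (simp add: scaleC_add_left)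
  show "a *\<^sub>C b *\<^sub>C f = (a * b) *\<^sub>C f" by (rule ell2_eqI) (simp add: scaleC_scaleC)
  show "cinner f g = cnj (cinner g f)"
    unfolding cinner_ell2_def by (subst cinner_commute) simp
  show "cinner (f + g) h = cinner f h + cinner g h"
    by (simp add: cinner_ell2_def cinner_add_left infsum_add)
  show "cinner (a *\<^sub>C f) g = a * cinner f g"
    by (simp add: cinner_ell2_def cinner_scaleC_left infsum_cmult_right')
  show "inner f g = Re (cinner f g)"
    by (simp add: cinner_ell2_def inner_ell2_def inner_eq_Re_cinner infsum_Re)
qed

end

section \<open>Closed subspaces and operators between them\<close>

text \<open>
  A Hilbert space is represented as a closed complex subspace of a type of class
  \<^class>\<open>chilbert_space\<close>, possibly the whole type. An operator defined on such a subspace is a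
  function on the type of which only the values on the subspace matter.
\<close>

definition hilbert_subspace :: "'a::chilbert_space set \<Rightarrow> bool" where
  "hilbert_subspace M \<longleftrightarrow> csubspace M \<and> closed M"

definition orth_compl :: "'a::chilbert_space set \<Rightarrow> 'a set" where
  "orth_compl M = {x. \<forall>y\<in>M. cinner x y = 0}"

definition orth_proj :: "'a::chilbert_space set \<Rightarrow> 'a \<Rightarrow> 'a" where
  "orth_proj M x = (THE y. y \<in> M \<and> x - y \<in> orth_compl M)"

definition bounded_clinear_on ::
  "'a::chilbert_space set \<Rightarrow> 'b::chilbert_space set \<Rightarrow> ('a \<Rightarrow> 'b) \<Rightarrow> bool" where
  "bounded_clinear_on M N T \<longleftrightarrow>
     (\<forall>x\<in>M. T x \<in> N) \<and>
     (\<forall>x\<in>M. \<forall>y\<in>M. T (x + y) = T x + T y) \<and>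
     (\<forall>c. \<forall>x\<in>M. T (c *\<^sub>C x) = c *\<^sub>C T x) \<and>
     (\<exists>C. \<forall>x\<in>M. norm (T x) \<le> C * norm x)"

definition similar_tuples ::
  "'a::chilbert_space set \<Rightarrow> ('n \<Rightarrow> 'a \<Rightarrow> 'a) \<Rightarrow> 'b::chilbert_space set \<Rightarrow> ('n \<Rightarrow> 'b \<Rightarrow> 'b) \<Rightarrow> bool" where
  "similar_tuples K V K' V' \<longleftrightarrow>
     (\<exists>X. bounded_clinear_on K K' X \<and> bij_betw X K K' \<and> bounded_clinear_on K' K (inv_into K X) \<and>
          (\<forall>i. \<forall>x\<in>K. X (V i x) = V' i (X x)))"

definition unitarily_equivalent_tuples ::
  "'a::chilbert_space set \<Rightarrow> ('n \<Rightarrow> 'a \<Rightarrow> 'a) \<Rightarrow> 'b::chilbert_space set \<Rightarrow> ('n \<Rightarrow> 'b \<Rightarrow> 'b) \<Rightarrow> bool" where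
  "unitarily_equivalent_tuples K V K' V' \<longleftrightarrow>
     (\<exists>U. bounded_clinear_on K K' U \<and> bij_betw U K K' \<and>
          (\<forall>x\<in>K. \<forall>y\<in>K. cinner (U x) (U y) = cinner x y) \<and>
          (\<forall>i. \<forall>x\<in>K. U (V i x) = V' i (U x)))"

lemma csubspace_orth_compl: "csubspace (orth_compl M)"
  by (auto simp: complex_vector.subspace_def orth_compl_def cinner_add_left cinner_scaleC_left)

lemma csubspace_orth_vec: "csubspace {y. cinner x y = 0}"
  by (auto simp: complex_vector.subspace_def cinner_add_right cinner_scaleC_right)

lemma csubspace_scaleR: "csubspace M \<Longrightarrow> x \<in> M \<Longrightarrow> r *\<^sub>R x \<in> M"
  by (metis complex_vector.subspace_scale scaleC_of_real)

lemma closed_orth_vec: "closed {y. cinner x y = 0}"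
proof -
  have "cinner x y = 0 \<longleftrightarrow> inner x y = 0 \<and> inner x (\<i> *\<^sub>C y) = 0" for y
    by (simp add: inner_eq_Re_cinner cinner_scaleC_right complex_eq_iff)
  moreover have "inner x (\<i> *\<^sub>C y) = inner (- \<i> *\<^sub>C x) y" for y
    by (simp add: inner_eq_Re_cinner cinner_scaleC_right cinner_scaleC_left cinner_minus_left)
  ultimately have "{y. cinner x y = 0} = {y. inner x y = 0} \<inter> {y. inner (- \<i> *\<^sub>C x) y = 0}"
    by auto
  then show ?thesis by (simp add: closed_Int closed_hyperplane)
qed

lemma nearest_point_exists:
  fixes M :: "'a::chilbert_space set"
  assumes M: "hilbert_subspace M"
  shows "\<exists>y\<in>M. \<forall>z\<in>M. norm (x - y) \<le> norm (x - z)"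
proof -
  have sub: "csubspace M" and cl: "closed M" using M by (auto simp: hilbert_subspace_def)
  have ne: "M \<noteq> {}" using complex_vector.subspace_0[OF sub] by auto
  define d where "d = infdist x M"
  have d0: "0 \<le> d" by (simp add: d_def infdist_nonneg)
  have dle: "d \<le> norm (x - z)" if "z \<in> M" for z
    using infdist_le[OF that, of x] by (simp add: d_def dist_norm)
  have "\<exists>y\<in>M. norm (x - y) < d + 1 / Suc n" for n
  proof (rule ccontr)
    assume "\<not> ?thesis"
    then have "d + 1 / Suc n \<le> dist x a" if "a \<in> M" for a using that by (auto simp: dist_norm not_less)
    then have "d + 1 / Suc n \<le> infdist x M"
      using ne unfolding infdist_notempty[OF ne] by (intro cINF_greatest) auto
    then show False by (simp add: d_def)
  qed
  then obtain y where yM: "\<And>n. y n \<in> M" and yd: "\<And>n. norm (x - y n) < d + 1 / Suc n"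
    by metis
  have par: "(norm (y m - y n))\<^sup>2 \<le> 2 * (norm (x - y m))\<^sup>2 + 2 * (norm (x - y n))\<^sup>2 - 4 * d\<^sup>2" for m n
  proof -
    define z where "z = (1/2) *\<^sub>R (y m + y n)"
    have "z \<in> M"
      unfolding z_def by (intro csubspace_scaleR[OF sub] complex_vector.subspace_add[OF sub] yM)
    then have "d\<^sup>2 \<le> (norm (x - z))\<^sup>2" using dle d0 by (intro power_mono) auto
    moreover have "(norm (y m - y n))\<^sup>2 = 2 * (norm (x - y m))\<^sup>2 + 2 * (norm (x - y n))\<^sup>2 - 4 * (norm (x - z))\<^sup>2"
      by (simp add: z_def power2_norm_eq_inner inner_diff_left inner_diff_right inner_add_left
          inner_add_right algebra_simps inner_commute)
    ultimately show ?thesis by simp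
  qed
  have lim0: "(\<lambda>n. d + 1 / Suc n) \<longlonglongrightarrow> d"
    using tendsto_add[OF tendsto_const LIMSEQ_inverse_real_of_nat, of d] by (simp add: inverse_eq_divide)
  have "Cauchy y"
  proof (rule CauchyI)
    fix e :: real assume e: "0 < e"
    have "(\<lambda>n. (d + 1 / Suc n)\<^sup>2) \<longlonglongrightarrow> d\<^sup>2" by (intro tendsto_power lim0)
    then have "\<forall>\<^sub>F n in sequentially. (d + 1 / Suc n)\<^sup>2 < d\<^sup>2 + e\<^sup>2 / 4"
      using e by (auto intro: order_tendstoD)
    then obtain N where N: "\<And>n. n \<ge> N \<Longrightarrow> (d + 1 / Suc n)\<^sup>2 < d\<^sup>2 + e\<^sup>2 / 4"
      by (auto simp: eventually_sequentially)
    have close: "(norm (x - y n))\<^sup>2 < d\<^sup>2 + e\<^sup>2 / 4" if "n \<ge> N" for n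
    proof -
      have "(norm (x - y n))\<^sup>2 \<le> (d + 1 / Suc n)\<^sup>2" using yd[of n] by (intro power_mono) auto
      then show ?thesis using N[OF that] by linarith
    qed
    have "norm (y m - y n) < e" if "m \<ge> N" "n \<ge> N" for m n
    proof -
      have "(norm (y m - y n))\<^sup>2 < e\<^sup>2"
        using par[of m n] close[OF that(1)] close[OF that(2)] by linarith
      then show ?thesis using e by (simp add: power2_less_imp_less)
    qed
    then show "\<exists>N. \<forall>m\<ge>N. \<forall>n\<ge>N. norm (y m - y n) < e" by (intro exI[of _ N]) simp
  qed
  then obtain l where l: "y \<longlonglongrightarrow> l" using Cauchy_convergent convergent_def by blast
  have "l \<in> M" using closed_sequentially[OF cl _ l] yM by simp
  moreover have "norm (x - l) \<le> d"
  proof (rule LIMSEQ_le)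
    show "(\<lambda>n. norm (x - y n)) \<longlonglongrightarrow> norm (x - l)" by (intro tendsto_intros l)
    show "(\<lambda>n. d + 1 / Suc n) \<longlonglongrightarrow> d" by (rule lim0)
    show "\<exists>N. \<forall>n\<ge>N. norm (x - y n) \<le> d + 1 / Suc n" using yd less_imp_le by blast
  qed
  ultimately show ?thesis using dle order_trans by blast
qed

lemma orth_decomposition:
  fixes M :: "'a::chilbert_space set"
  assumes M: "hilbert_subspace M"
  shows "\<exists>!y. y \<in> M \<and> x - y \<in> orth_compl M"
proof -
  have sub: "csubspace M" using M by (auto simp: hilbert_subspace_def)
  obtain y where yM: "y \<in> M" and ymin: "\<And>z. z \<in> M \<Longrightarrow> norm (x - y) \<le> norm (x - z)"
    using nearest_point_exists[OF M] by blast
  have inner0: "inner (x - y) z = 0" if z: "z \<in> M" for z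
  proof (cases "z = 0")
    case False
    define p where "p = inner (x - y) z"
    define q where "q = inner z z"
    have q: "q > 0" using False by (simp add: q_def)
    have "y + (p / q) *\<^sub>R z \<in> M"
      by (intro complex_vector.subspace_add[OF sub] csubspace_scaleR[OF sub] yM z)
    then have "(norm (x - y))\<^sup>2 \<le> (norm (x - (y + (p / q) *\<^sub>R z)))\<^sup>2"
      by (intro power_mono ymin) auto
    also have "x - (y + (p / q) *\<^sub>R z) = (x - y) - (p / q) *\<^sub>R z" by simp
    also have "(norm \<dots>)\<^sup>2 = (norm (x - y))\<^sup>2 - 2 * (p / q) * p + (p / q)\<^sup>2 * q"
    proof -
      have "(norm (w - t *\<^sub>R z))\<^sup>2 = (norm w)\<^sup>2 - 2 * t * inner w z + t\<^sup>2 * inner z z" for w t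
        unfolding power2_norm_eq_inner
        by (simp add: inner_diff_left inner_diff_right inner_commute power2_eq_square algebra_simps)
      then show ?thesis by (simp add: p_def q_def)
    qed
    also have "\<dots> = (norm (x - y))\<^sup>2 - p\<^sup>2 / q" using q by (simp add: field_simps power2_eq_square)
    finally have "p\<^sup>2 / q \<le> 0" by simp
    then show ?thesis using q by (simp add: p_def divide_le_0_iff)
  qed simp
  have "cinner (x - y) z = 0" if z: "z \<in> M" for z
    using inner0[OF z] inner0[OF complex_vector.subspace_scale[OF sub z, of \<i>]]
    by (simp add: inner_eq_Re_cinner cinner_scaleC_right complex_eq_iff)
  then have y: "y \<in> M \<and> x - y \<in> orth_compl M" using yM by (simp add: orth_compl_def)
  moreover have "y' = y" if y': "y' \<in> M \<and> x - y' \<in> orth_compl M" for y'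
  proof -
    have m: "y - y' \<in> M" using y y' complex_vector.subspace_diff[OF sub] by blast
    have "(x - y') - (x - y) \<in> orth_compl M"
      using y y' complex_vector.subspace_diff[OF csubspace_orth_compl] by blast
    then have "cinner (y - y') (y - y') = 0" using m by (simp add: orth_compl_def)
    then show "y' = y" by (simp add: cinner_self)
  qed
  ultimately show ?thesis by blast
qed

lemma orth_proj:
  assumes "hilbert_subspace M"
  shows orth_proj_in: "orth_proj M x \<in> M" and orth_proj_diff: "x - orth_proj M x \<in> orth_compl M"
  using theI'[OF orth_decomposition[OF assms, of x]] unfolding orth_proj_def by auto

lemma orth_proj_eqI:
  assumes "hilbert_subspace M" "y \<in> M" "x - y \<in> orth_compl M"
  shows "orth_proj M x = y"
  using orth_decomposition[OF assms(1), of x] orth_proj[OF assms(1), of x] assms(2,3) by blast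

lemma bounded_clinear_on_orth_proj:
  fixes M :: "'a::chilbert_space set"
  assumes M: "hilbert_subspace M"
  shows "bounded_clinear_on UNIV M (orth_proj M)"
proof -
  have sub: "csubspace M" using M by (auto simp: hilbert_subspace_def)
  note P = orth_proj[OF M] and eqI = orth_proj_eqI[OF M]
  have add: "orth_proj M (x + y) = orth_proj M x + orth_proj M y" for x y
  proof (rule eqI)
    show "orth_proj M x + orth_proj M y \<in> M" by (intro complex_vector.subspace_add[OF sub] P)
    have "x + y - (orth_proj M x + orth_proj M y) = (x - orth_proj M x) + (y - orth_proj M y)" by simp
    also have "\<dots> \<in> orth_compl M"
      by (intro complex_vector.subspace_add[OF csubspace_orth_compl] P)
    finally show "x + y - (orth_proj M x + orth_proj M y) \<in> orth_compl M" .
  qed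
  have scale: "orth_proj M (c *\<^sub>C x) = c *\<^sub>C orth_proj M x" for c x
  proof (rule eqI)
    show "c *\<^sub>C orth_proj M x \<in> M" by (intro complex_vector.subspace_scale[OF sub] P)
    have "c *\<^sub>C (x - orth_proj M x) \<in> orth_compl M"
      by (intro complex_vector.subspace_scale[OF csubspace_orth_compl] P)
    then show "c *\<^sub>C x - c *\<^sub>C orth_proj M x \<in> orth_compl M"
      by (simp add: complex_vector.scale_right_diff_distrib)
  qed
  have bound: "norm (orth_proj M x) \<le> 1 * norm x" for x
  proof -
    have "inner (x - orth_proj M x) (orth_proj M x) = 0"
      using P[of x] by (simp add: orth_compl_def inner_eq_Re_cinner)
    then have "(norm (orth_proj M x))\<^sup>2 = inner x (orth_proj M x)"
      by (simp add: power2_norm_eq_inner inner_diff_left)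
    also have "\<dots> \<le> norm x * norm (orth_proj M x)" by (rule norm_cauchy_schwarz)
    finally have "norm (orth_proj M x) * norm (orth_proj M x) \<le> norm x * norm (orth_proj M x)"
      by (simp add: power2_eq_square)
    then show ?thesis by (cases "orth_proj M x = 0") auto
  qed
  show ?thesis
    unfolding bounded_clinear_on_def
    using P(1) add scale bound by (intro conjI allI ballI exI[of _ 1]) auto
qed


section \<open>The full Fock space and the noncommutative analytic Toeplitz algebra\<close>

text \<open>
  With respect to the orthonormal basis of all words \<open>e\<^bsub>i\<^sub>1\<^esub> \<otimes> \<dots> \<otimes> e\<^bsub>i\<^sub>k\<^esub>\<close> in the orthonormal basis
  \<open>(e\<^sub>i)\<close> of \<open>H\<^sub>n\<close>, the full Fock space \<open>\<Oplus>\<^sub>k H\<^sub>n\<^bsup>\<otimes>k\<^esup>\<close> is the space of square-summable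
  complex families indexed by lists over an index type with \<open>n\<close> elements; the empty word is the
  basis vector of \<open>H\<^sub>n\<^bsup>\<otimes>0\<^esup>\<close>.
\<close>

type_synonym 'n fock = "('n list, complex) ell2"

definition vacuum :: "'n fock" where
  "vacuum = Abs_ell2 (\<lambda>w. if w = [] then 1 else 0)"

text \<open>
  On the Fock space this is \<open>S\<^sub>i \<phi> = e\<^sub>i \<otimes> \<phi>\<close>. For coefficients in a Hilbert space \<open>\<H>\<close> it is
  \<open>S\<^sub>i \<otimes> I\<close> on \<open>F\<^sup>2(H\<^sub>n) \<otimes> \<H>\<close>.
\<close>

definition left_creation :: "'n \<Rightarrow> ('n list, 'a::chilbert_space) ell2 \<Rightarrow> ('n list, 'a) ell2" where
  "left_creation i f =
     Abs_ell2 (\<lambda>w. case w of [] \<Rightarrow> 0 | j # v \<Rightarrow> if j = i then ell2_apply f v else 0)"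

definition bounded_ops :: "('a::chilbert_space \<Rightarrow> 'a) set" where
  "bounded_ops = {T. bounded_clinear_on UNIV UNIV T}"

definition wot :: "('a::chilbert_space \<Rightarrow> 'a) topology" where
  "wot = topology_generated_by {{T \<in> bounded_ops. cinner (T x) y \<in> U} | x y U. open U}"

definition operator_subspace :: "('a::chilbert_space \<Rightarrow> 'a) set \<Rightarrow> bool" where
  "operator_subspace A \<longleftrightarrow> A \<subseteq> bounded_ops \<and> (\<lambda>_. 0) \<in> A \<and>
     (\<forall>S\<in>A. \<forall>T\<in>A. (\<lambda>x. S x + T x) \<in> A) \<and> (\<forall>c. \<forall>T\<in>A. (\<lambda>x. c *\<^sub>C T x) \<in> A)"

definition wot_closed_algebra :: "('a::chilbert_space \<Rightarrow> 'a) set \<Rightarrow> bool" where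
  "wot_closed_algebra A \<longleftrightarrow>
     operator_subspace A \<and> (\<forall>S\<in>A. \<forall>T\<in>A. S \<circ> T \<in> A) \<and> closedin wot A"

definition F_infinity :: "('n fock \<Rightarrow> 'n fock) set" where
  "F_infinity = wot_closed_algebra hull (insert id (range left_creation))"

definition wot_closed_ideal :: "('n fock \<Rightarrow> 'n fock) set \<Rightarrow> bool" where
  "wot_closed_ideal J \<longleftrightarrow> J \<subseteq> F_infinity \<and> operator_subspace J \<and>
     (\<forall>A\<in>F_infinity. \<forall>T\<in>J. A \<circ> T \<in> J \<and> T \<circ> A \<in> J) \<and> closedin wot J"


section \<open>Constrained shifts\<close>

definition N_space :: "('n fock \<Rightarrow> 'n fock) set \<Rightarrow> 'n fock set" where
  "N_space J = orth_compl (closure (cspan {T \<phi> | T \<phi>. T \<in> J}))"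

definition B_shift :: "('n fock \<Rightarrow> 'n fock) set \<Rightarrow> 'n \<Rightarrow> 'n fock \<Rightarrow> 'n fock" where
  "B_shift J i \<phi> = orth_proj (N_space J) (left_creation i \<phi>)"

text \<open>
  \<open>F\<^sup>2(H\<^sub>n) \<otimes> \<H>\<close> is realised as the space of square-summable \<open>\<H>\<close>-valued families indexed by words,
  and \<open>N \<otimes> H\<close>, for closed subspaces \<open>N\<close> and \<open>H\<close>, as the closed linear span in it of the elementary
  tensors.
\<close>

definition tensor :: "('i, complex) ell2 \<Rightarrow> 'h::chilbert_space \<Rightarrow> ('i, 'h) ell2" where
  "tensor \<phi> h = Abs_ell2 (\<lambda>w. ell2_apply \<phi> w *\<^sub>C h)"

definition tensor_space ::
  "('i, complex) ell2 set \<Rightarrow> 'h::chilbert_space set \<Rightarrow> ('i, 'h) ell2 set" where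
  "tensor_space N H = closure (cspan {tensor \<phi> h | \<phi> h. \<phi> \<in> N \<and> h \<in> H})"

text \<open>
  For an operator \<open>T\<close> on \<open>N\<close>, the ampliation \<open>T \<otimes> I\<^bsub>H\<^esub>\<close>; its values on \<open>N \<otimes> H\<close> are determined by
  the two conditions. Existence for the operators of interest is proved at the end of the theory.
\<close>

definition is_ampliation ::
  "('i, complex) ell2 set \<Rightarrow> 'h::chilbert_space set \<Rightarrow> (('i, complex) ell2 \<Rightarrow> ('i, complex) ell2)
     \<Rightarrow> (('i, 'h) ell2 \<Rightarrow> ('i, 'h) ell2) \<Rightarrow> bool" where
  "is_ampliation N H T W \<longleftrightarrow> bounded_clinear_on (tensor_space N H) (tensor_space N H) W \<and>
     (\<forall>\<phi>\<in>N. \<forall>h\<in>H. W (tensor \<phi> h) = tensor (T \<phi>) h)"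

definition ampliation ::
  "('i, complex) ell2 set \<Rightarrow> 'h::chilbert_space set \<Rightarrow> (('i, complex) ell2 \<Rightarrow> ('i, complex) ell2)
     \<Rightarrow> ('i, 'h) ell2 \<Rightarrow> ('i, 'h) ell2" where
  "ampliation N H T = (SOME W. is_ampliation N H T W)"

text \<open>
  The tuple \<open>V\<close> on \<open>K\<close> is a constrained shift associated with \<open>J\<close>, of multiplicity \<open>dim H\<close>.
\<close>

definition constrained_shift ::
  "('n fock \<Rightarrow> 'n fock) set \<Rightarrow> 'h::chilbert_space set \<Rightarrow> 'k::chilbert_space set \<Rightarrow> ('n \<Rightarrow> 'k \<Rightarrow> 'k) \<Rightarrow> bool" where
  "constrained_shift J H K V \<longleftrightarrow> hilbert_subspace H \<and> hilbert_subspace K \<and>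
     unitarily_equivalent_tuples
       (tensor_space (N_space J) H) (\<lambda>i. ampliation (N_space J) H (B_shift J i)) K V"

lemma hilbert_subspace_orth_compl: "hilbert_subspace (orth_compl (M :: 'a::chilbert_space set))"
proof -
  have "orth_compl M = (\<Inter>y\<in>M. {x. cinner y x = 0})"
  proof -
    have "cinner x y = 0 \<longleftrightarrow> cinner y x = 0" for x y :: 'a
      using cinner_commute[of x y] by simp
    then show ?thesis by (auto simp: orth_compl_def)
  qed
  then have "closed (orth_compl M)" by (simp add: closed_INT closed_orth_vec)
  then show ?thesis by (simp add: hilbert_subspace_def csubspace_orth_compl)
qed

lemma hilbert_subspace_N_space: "hilbert_subspace (N_space J)"
  unfolding N_space_def by (rule hilbert_subspace_orth_compl)

lemma square_summable_case_list:
  fixes f :: "('n list, 'a::chilbert_space) ell2"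
  fixes i :: 'n
  defines "g \<equiv> \<lambda>w. case w of [] \<Rightarrow> 0 | j # v \<Rightarrow> if j = i then ell2_apply f v else 0"
  shows "((\<lambda>w. (norm (g w))\<^sup>2) has_sum (norm f)\<^sup>2) UNIV"
proof -
  have "((\<lambda>v. (norm (ell2_apply f v))\<^sup>2) has_sum (norm f)\<^sup>2) UNIV"
    unfolding norm_ell2_square by (rule has_sum_infsum[OF ell2_summable])
  then have "((\<lambda>w. (norm (g w))\<^sup>2) has_sum (norm f)\<^sup>2) (range (Cons i))"
    by (subst has_sum_reindex) (auto simp: inj_on_def o_def g_def)
  then show ?thesis
    by (rule has_sum_cong_neutral[THEN iffD1, rotated -1])
       (auto simp: g_def split: list.splits if_splits)
qed

lemma left_creation_apply:
  "ell2_apply (left_creation i f) w =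
     (case w of [] \<Rightarrow> 0 | j # v \<Rightarrow> if j = i then ell2_apply f v else 0)"
  unfolding left_creation_def
  by (subst Abs_ell2_inverse) (use square_summable_case_list[of i f] in \<open>auto simp: summable_on_def\<close>)

lemma norm_left_creation: "norm (left_creation i f) = norm f"
proof -
  have "(norm (left_creation i f))\<^sup>2 = (norm f)\<^sup>2"
    unfolding norm_ell2_square[of "left_creation i f"] left_creation_apply
    by (rule infsumI[OF square_summable_case_list])
  then show ?thesis by simp
qed

lemma left_creation_add: "left_creation i (f + g) = left_creation i f + left_creation i g"
  by (rule ell2_eqI) (simp add: left_creation_apply split: list.split)

lemma left_creation_scaleC: "left_creation i (c *\<^sub>C f) = c *\<^sub>C left_creation i f"
  by (rule ell2_eqI) (simp add: left_creation_apply split: list.split)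

lemma left_creation_bounded: "left_creation i \<in> bounded_ops"
  unfolding bounded_ops_def bounded_clinear_on_def
  by (auto simp: left_creation_add left_creation_scaleC norm_left_creation intro!: exI[of _ 1])

lemma tensor_apply: "ell2_apply (tensor \<phi> h) w = ell2_apply \<phi> w *\<^sub>C h"
  unfolding tensor_def
  by (subst Abs_ell2_inverse)
     (auto simp: norm_scaleC power_mult_distrib intro!: summable_on_cmult_left ell2_summable)

lemma cinner_tensor: "cinner (tensor \<phi> h) (tensor \<psi> k) = cinner \<phi> \<psi> * cinner h k"
proof -
  have "cinner (tensor \<phi> h) (tensor \<psi> k)
      = (\<Sum>\<^sub>\<infinity>w. cinner (ell2_apply \<phi> w) (ell2_apply \<psi> w) * cinner h k)"
    unfolding cinner_ell2_def tensor_apply cinner_scaleC_left cinner_scaleC_right cinner_complex_def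
    by (simp only: mult_ac)
  also have "\<dots> = cinner \<phi> \<psi> * cinner h k"
    unfolding cinner_ell2_def by (rule infsum_cmult_left')
  finally show ?thesis .
qed

lemma tensor_diff_left: "tensor (\<phi> - \<psi>) h = tensor \<phi> h - tensor \<psi> h"
  by (rule ell2_eqI) (simp add: tensor_apply complex_vector.scale_left_diff_distrib)

lemma left_creation_tensor: "left_creation i (tensor \<phi> h) = tensor (left_creation i \<phi>) h"
  by (rule ell2_eqI) (simp add: left_creation_apply tensor_apply split: list.split)

lemma csubspace_closure:
  fixes M :: "'a::chilbert_space set"
  assumes "csubspace M" shows "csubspace (closure M)"
proof -
  have cont: "continuous_on UNIV (\<lambda>x::'a. c *\<^sub>C x)" for c
    by (rule lipschitz_on_continuous_on[where L = "cmod c"], rule lipschitz_onI)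
       (simp_all add: dist_norm complex_vector.scale_right_diff_distrib[symmetric] norm_scaleC)
  have "x + y \<in> closure M" if x: "x \<in> closure M" and y: "y \<in> closure M" for x y
  proof -
    obtain f g where "\<forall>n. f n \<in> M" "f \<longlonglongrightarrow> x" "\<forall>n. g n \<in> M" "g \<longlonglongrightarrow> y"
      using x y unfolding closure_sequential by blast
    then have "\<forall>n. f n + g n \<in> M" "(\<lambda>n. f n + g n) \<longlonglongrightarrow> x + y"
      by (auto intro: complex_vector.subspace_add[OF assms] tendsto_add)
    then show ?thesis unfolding closure_sequential by (intro exI conjI)
  qed
  moreover have "c *\<^sub>C x \<in> closure M" if x: "x \<in> closure M" for c x
  proof -
    obtain f where "\<forall>n. f n \<in> M" "f \<longlonglongrightarrow> x" using x unfolding closure_sequential by blast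
    then have "\<forall>n. c *\<^sub>C f n \<in> M" "(\<lambda>n. c *\<^sub>C f n) \<longlonglongrightarrow> c *\<^sub>C x"
      using continuous_on_tendsto_compose[OF cont]
      by (auto intro: complex_vector.subspace_scale[OF assms])
    then show ?thesis unfolding closure_sequential by (intro exI conjI)
  qed
  moreover have "0 \<in> closure M" using complex_vector.subspace_0[OF assms] closure_subset by blast
  ultimately show ?thesis by (simp add: complex_vector.subspace_def)
qed

lemma hilbert_subspace_tensor_space: "hilbert_subspace (tensor_space N H)"
  by (simp add: hilbert_subspace_def tensor_space_def csubspace_closure complex_vector.subspace_span)

lemma tensor_in_tensor_space: "\<phi> \<in> N \<Longrightarrow> h \<in> H \<Longrightarrow> tensor \<phi> h \<in> tensor_space N H"
  unfolding tensor_space_def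
  by (rule closure_subset[THEN subsetD], rule complex_vector.span_base) blast

lemma tensor_orth_compl:
  assumes "\<psi> \<in> orth_compl N" shows "tensor \<psi> k \<in> orth_compl (tensor_space N H)"
proof -
  have "{tensor \<phi> h | \<phi> h. \<phi> \<in> N \<and> h \<in> H} \<subseteq> {y. cinner (tensor \<psi> k) y = 0}"
    using assms by (auto simp: cinner_tensor orth_compl_def)
  then have "cspan {tensor \<phi> h | \<phi> h. \<phi> \<in> N \<and> h \<in> H} \<subseteq> {y. cinner (tensor \<psi> k) y = 0}"
    by (rule complex_vector.span_minimal[OF _ csubspace_orth_vec])
  then have "tensor_space N H \<subseteq> {y. cinner (tensor \<psi> k) y = 0}"
    unfolding tensor_space_def by (rule closure_minimal[OF _ closed_orth_vec])
  then show ?thesis by (auto simp: orth_compl_def)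
qed

lemma is_ampliation_B_shift:
  "is_ampliation (N_space J) H (B_shift J i)
     (\<lambda>f. orth_proj (tensor_space (N_space J) H) (left_creation i f))"
proof -
  let ?N = "N_space J" and ?M = "tensor_space (N_space J) H"
  note P = bounded_clinear_on_orth_proj[OF hilbert_subspace_tensor_space[of ?N H],
      unfolded bounded_clinear_on_def]
  obtain C where C: "\<And>x. norm (orth_proj ?M x) \<le> C * norm x" using P by blast
  have "norm (orth_proj ?M (left_creation i f)) \<le> C * norm f" for f
    using C[of "left_creation i f"] by (simp add: norm_left_creation)
  then have "bounded_clinear_on ?M ?M (\<lambda>f. orth_proj ?M (left_creation i f))"
    unfolding bounded_clinear_on_def left_creation_add left_creation_scaleC
    using P by (intro conjI) (blast, blast, blast, blast)
  moreover have "orth_proj ?M (left_creation i (tensor \<phi> h)) = tensor (B_shift J i \<phi>) h"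
    if "h \<in> H" for \<phi> h
  proof (rule orth_proj_eqI[OF hilbert_subspace_tensor_space])
    show "tensor (B_shift J i \<phi>) h \<in> ?M"
      unfolding B_shift_def
      by (intro tensor_in_tensor_space orth_proj_in hilbert_subspace_N_space that)
    show "left_creation i (tensor \<phi> h) - tensor (B_shift J i \<phi>) h \<in> orth_compl ?M"
      unfolding left_creation_tensor tensor_diff_left[symmetric] B_shift_def
      by (intro tensor_orth_compl orth_proj_diff hilbert_subspace_N_space)
  qed
  ultimately show ?thesis unfolding is_ampliation_def by blast
qed

lemma is_ampliation_ampliation:
  "is_ampliation (N_space J) H (B_shift J i) (ampliation (N_space J) H (B_shift J i))"
  unfolding ampliation_def by (rule someI[where P = "is_ampliation _ _ _"], rule is_ampliation_B_shift)

end

(*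
  Since the vacuum lies in N, the wandering subspace of the shift B_i (x) I on N (x) H is 1 (x) H:
  every f in N (x) H is 1 (x) f_0 plus a sum of values of the B_i (x) I, where f_0 is the component
  at the empty word, and the ranges of the B_i (x) I have no such component. A similarity X of two
  shifts maps ranges to ranges, so h |-> (X (1 (x) h))_0 is a bounded invertible operator H -> H'.
  Its polar decomposition contains a unitary U : H -> H', and I (x) U intertwines the two shifts.
*)

theory Submission
  imports Defs
begin

section \<open>Bounded complex-linear maps\<close>

text \<open>The coefficient spaces H and H' may live in unrelated types, so equality of
  multiplicities is expressed by a unitary H -> H' and not by cardinal numbers; hence a polar
  decomposition and no orthonormal bases. The decomposition of f rests on co-invariance: J is a left
  ideal, so the closure of J F^2 is invariant under each S_i, and N under the adjoints. Thus the
  adjoint of S_i \<otimes> I maps f back into N \<otimes> H, and the decomposition of f in the full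
  Fock space can be compressed to N \<otimes> H. That 1 lies in N enters twice: the compression
  fixes 1 \<otimes> f_0, and 1 \<otimes> H is part of N \<otimes> H, so the ranges of the shifts can
  be tested against it. The inverse of h |-> (X (1 \<otimes> h))_0 is the same map formed with the
  inverse of X: X (1 \<otimes> h) differs from 1 \<otimes> (its vacuum component) by values of the
  shifts over H', which the inverse turns into values of the shifts over H, invisible at the empty
  word. Operators on H are functions on an ambient type; adjoints and square roots are formed there,
  after composition with the projection onto H.\<close>

lemma bounded_clinear_onI:
  assumes "\<And>x. x \<in> M \<Longrightarrow> T x \<in> N"
    and "\<And>x y. x \<in> M \<Longrightarrow> y \<in> M \<Longrightarrow> T (x + y) = T x + T y"
    and "\<And>c x. x \<in> M \<Longrightarrow> T (c *\<^sub>C x) = c *\<^sub>C T x"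
    and "\<And>x. x \<in> M \<Longrightarrow> norm (T x) \<le> C * norm x"
  shows "bounded_clinear_on M N T"
  using assms unfolding bounded_clinear_on_def by blast

lemma
  assumes "bounded_clinear_on M N T"
  shows bounded_clinear_on_in: "x \<in> M \<Longrightarrow> T x \<in> N"
    and bounded_clinear_on_add: "x \<in> M \<Longrightarrow> y \<in> M \<Longrightarrow> T (x + y) = T x + T y"
    and bounded_clinear_on_scaleC: "x \<in> M \<Longrightarrow> T (c *\<^sub>C x) = c *\<^sub>C T x"
  using assms unfolding bounded_clinear_on_def by blast+

lemma bounded_clinear_on_bound:
  assumes "bounded_clinear_on M N T"
  shows "\<exists>C>0. \<forall>x\<in>M. norm (T x) \<le> C * norm x"
proof -
  obtain C where C: "\<And>x. x \<in> M \<Longrightarrow> norm (T x) \<le> C * norm x"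
    using assms unfolding bounded_clinear_on_def by blast
  have "norm (T x) \<le> (\<bar>C\<bar> + 1) * norm x" if "x \<in> M" for x
    using order_trans[OF C[OF that] mult_right_mono[of C "\<bar>C\<bar> + 1" "norm x"]] by simp
  then show ?thesis by (intro exI[of _ "\<bar>C\<bar> + 1"]) simp
qed

lemma bounded_clinear_on_diff:
  assumes "bounded_clinear_on M N T" "csubspace M" "x \<in> M" "y \<in> M"
  shows "T (x - y) = T x - T y"
  using bounded_clinear_on_add[OF assms(1), of "x - y" y] complex_vector.subspace_diff[OF assms(2)] assms
  by simp

lemma bounded_clinear_on_zero:
  assumes "bounded_clinear_on M N T" "csubspace M"
  shows "T 0 = 0"
  using bounded_clinear_on_diff[OF assms, of 0 0] complex_vector.subspace_0[OF assms(2)] by simp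

lemma bounded_clinear_on_sum:
  assumes "bounded_clinear_on M N T" "csubspace M" "finite I" "\<And>i. i \<in> I \<Longrightarrow> f i \<in> M"
  shows "T (\<Sum>i\<in>I. f i) = (\<Sum>i\<in>I. T (f i))"
  using assms(3,4)
proof (induction I rule: finite_induct)
  case empty
  show ?case using bounded_clinear_on_zero[OF assms(1,2)] by simp
next
  case (insert i I)
  then show ?case
    using bounded_clinear_on_add[OF assms(1)] complex_vector.subspace_sum[OF assms(2), of I f] by simp
qed

lemma bounded_clinear_on_compose:
  assumes S: "bounded_clinear_on L M S" and T: "bounded_clinear_on M N T"
  shows "bounded_clinear_on L N (\<lambda>x. T (S x))"
proof -
  obtain C where C: "C > 0" "\<And>x. x \<in> L \<Longrightarrow> norm (S x) \<le> C * norm x"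
    using bounded_clinear_on_bound[OF S] by blast
  obtain D where D: "D > 0" "\<And>x. x \<in> M \<Longrightarrow> norm (T x) \<le> D * norm x"
    using bounded_clinear_on_bound[OF T] by blast
  show ?thesis
  proof (rule bounded_clinear_onI[where C = "D * C"])
    fix x assume x: "x \<in> L"
    have "norm (T (S x)) \<le> D * norm (S x)" using D x bounded_clinear_on_in[OF S] by blast
    also have "\<dots> \<le> D * (C * norm x)" using C D x by (intro mult_left_mono) auto
    finally show "norm (T (S x)) \<le> D * C * norm x" by simp
  qed (simp_all add: bounded_clinear_on_in[OF S] bounded_clinear_on_in[OF T]
      bounded_clinear_on_add[OF S] bounded_clinear_on_add[OF T]
      bounded_clinear_on_scaleC[OF S] bounded_clinear_on_scaleC[OF T])
qed

lemma bounded_clinear_on_mono: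
  assumes "bounded_clinear_on M N T" "M' \<subseteq> M" "\<And>x. x \<in> M' \<Longrightarrow> T x \<in> N'"
  shows "bounded_clinear_on M' N' T"
  using assms unfolding bounded_clinear_on_def by (meson subsetD)

lemma bounded_clinear_on_cong:
  assumes "bounded_clinear_on M N T" "csubspace M" "\<And>x. x \<in> M \<Longrightarrow> T' x = T x"
  shows "bounded_clinear_on M N T'"
  using assms complex_vector.subspace_add[OF assms(2)] complex_vector.subspace_scale[OF assms(2)]
  unfolding bounded_clinear_on_def by auto

lemma bounded_clinear_on_continuous:
  assumes "bounded_clinear_on M N T" "csubspace M"
  shows "continuous_on M T"
proof -
  obtain C where C: "C > 0" "\<And>x. x \<in> M \<Longrightarrow> norm (T x) \<le> C * norm x"
    using bounded_clinear_on_bound[OF assms(1)] by blast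
  show ?thesis
  proof (rule lipschitz_on_continuous_on[where L = C], rule lipschitz_onI)
    fix x y assume "x \<in> M" "y \<in> M"
    then show "dist (T x) (T y) \<le> C * dist x y"
      using C(2)[of "x - y"] complex_vector.subspace_diff[OF assms(2)]
      by (simp add: dist_norm bounded_clinear_on_diff[OF assms])
  qed (use C in simp)
qed

lemma bounded_clinear_on_UNIV_bounded_linear:
  assumes "bounded_clinear_on UNIV N T"
  shows "bounded_linear T"
proof -
  obtain C where C: "\<And>x. norm (T x) \<le> C * norm x"
    using bounded_clinear_on_bound[OF assms] by auto
  show ?thesis
  proof (rule bounded_linear_intro[where K = C])
    show "T (r *\<^sub>R x) = r *\<^sub>R T x" for r x
      unfolding scaleC_of_real[symmetric] by (rule bounded_clinear_on_scaleC[OF assms]) simp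
    show "norm (T x) \<le> norm x * C" for x using C[of x] by (simp add: mult.commute)
  qed (simp add: bounded_clinear_on_add[OF assms])
qed

text \<open>The lower bound on \<open>T\<close> is what bounds the inverse, so the open mapping
  theorem is avoided.\<close>

lemma bounded_clinear_on_inv_into:
  assumes T: "bounded_clinear_on M N T" and M: "csubspace M" and bij: "bij_betw T M N"
    and low: "\<And>x. x \<in> M \<Longrightarrow> norm x \<le> C * norm (T x)"
  shows "bounded_clinear_on N M (inv_into M T)"
proof -
  have inM: "inv_into M T y \<in> M" and TT: "T (inv_into M T y) = y" if "y \<in> N" for y
    using that bij by (auto simp: bij_betw_def inv_into_into f_inv_into_f)
  have eq: "inv_into M T y = x" if "x \<in> M" "T x = y" for x y
    using that bij by (auto simp: bij_betw_def inv_into_f_f)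
  show ?thesis
  proof (rule bounded_clinear_onI[where C = C])
    show "inv_into M T (x + y) = inv_into M T x + inv_into M T y" if "x \<in> N" "y \<in> N" for x y
      using that by (intro eq) (simp_all add: inM TT complex_vector.subspace_add[OF M] bounded_clinear_on_add[OF T])
    show "inv_into M T (c *\<^sub>C x) = c *\<^sub>C inv_into M T x" if "x \<in> N" for c x
      using that by (intro eq) (simp_all add: inM TT complex_vector.subspace_scale[OF M] bounded_clinear_on_scaleC[OF T])
    show "norm (inv_into M T y) \<le> C * norm y" if "y \<in> N" for y
      using low[OF inM[OF that]] TT[OF that] by simp
  qed (rule inM)
qed

lemma continuous_on_scaleC: "continuous_on UNIV (\<lambda>x::'a::chilbert_space. c *\<^sub>C x)"
  by (rule bounded_clinear_on_continuous[where N = UNIV], rule bounded_clinear_onI[where C = "cmod c"])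
     (simp_all add: scaleC_add_right norm_scaleC complex_vector.scale_left_commute)

text \<open>With \<open>G\<close> the elementary tensors, this reduces operator identities on
  \<open>tensor_space\<close> to elementary tensors: the equalizer is a subspace, and continuity
  carries it to the closure.\<close>

lemma bounded_clinear_on_closure_cspan_eq:
  assumes S: "bounded_clinear_on (closure (cspan G)) N S" and T: "bounded_clinear_on (closure (cspan G)) N' T"
    and eq: "\<And>x. x \<in> G \<Longrightarrow> S x = T x" and x: "x \<in> closure (cspan G)"
  shows "S x = T x"
proof -
  let ?M = "closure (cspan G)"
  have M: "csubspace ?M" by (simp add: csubspace_closure)
  have sub: "cspan G \<subseteq> ?M" by (rule closure_subset)
  have "csubspace {x \<in> ?M. S x = T x}"
    using M bounded_clinear_on_zero[OF S M] bounded_clinear_on_zero[OF T M]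
    by (auto simp: complex_vector.subspace_def bounded_clinear_on_add[OF S] bounded_clinear_on_add[OF T]
        bounded_clinear_on_scaleC[OF S] bounded_clinear_on_scaleC[OF T])
  moreover have "G \<subseteq> {x \<in> ?M. S x = T x}"
    using sub eq complex_vector.span_superset by auto
  ultimately have span: "S x = T x" if "x \<in> cspan G" for x
    using complex_vector.span_minimal that by blast
  obtain f where f: "\<And>n. f n \<in> cspan G" "f \<longlonglongrightarrow> x"
    using x unfolding closure_sequential by blast
  have fM: "f n \<in> ?M" for n using f(1) sub by (rule subsetD[rotated])
  then have ev: "\<forall>\<^sub>F n in sequentially. f n \<in> ?M" by simp
  have "(\<lambda>n. S (f n)) \<longlonglongrightarrow> S x" "(\<lambda>n. T (f n)) \<longlonglongrightarrow> T x"
    by (rule continuous_on_tendsto_compose[OF bounded_clinear_on_continuous[OF S M] f(2) x ev])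
       (rule continuous_on_tendsto_compose[OF bounded_clinear_on_continuous[OF T M] f(2) x ev])
  then show ?thesis using span[OF f(1)] LIMSEQ_unique by simp
qed

text \<open>Companion of the previous lemma for mapping properties: the preimage of a closed
  subspace is a closed subspace, so generators suffice.\<close>

lemma bounded_clinear_on_closure_cspan_in:
  assumes T: "bounded_clinear_on UNIV UNIV T" and N: "hilbert_subspace N"
    and G: "\<And>x. x \<in> G \<Longrightarrow> T x \<in> N" and x: "x \<in> closure (cspan G)"
  shows "T x \<in> N"
proof -
  have cl: "closed {x. T x \<in> N}"
    using bounded_clinear_on_continuous[OF T] N
    by (auto simp: hilbert_subspace_def complex_vector.subspace_UNIV vimage_def
        intro: closed_vimage[unfolded vimage_def])
  have "csubspace {x. T x \<in> N}"
    using N bounded_clinear_on_zero[OF T]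
    by (auto simp: hilbert_subspace_def complex_vector.subspace_def bounded_clinear_on_add[OF T]
        bounded_clinear_on_scaleC[OF T])
  then have "cspan G \<subseteq> {x. T x \<in> N}"
    using G by (intro complex_vector.span_minimal) auto
  then show ?thesis using closure_minimal[OF _ cl] x by blast
qed


section \<open>Adjoints and polar decomposition\<close>

lemma riesz_representation:
  fixes f :: "'a::chilbert_space \<Rightarrow> complex"
  assumes f: "bounded_clinear_on UNIV UNIV f"
  shows "\<exists>y. \<forall>x. f x = cinner x y"
proof (cases "\<forall>x. f x = 0")
  case False
  then obtain x where x: "f x \<noteq> 0" by blast
  let ?M = "{x. f x = 0}"
  have fs: "f (c *\<^sub>C x) = c * f x" for c x
    using bounded_clinear_on_scaleC[OF f] by (simp add: scaleC_complex_def)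
  have fd: "f (x - y) = f x - f y" for x y
    using bounded_clinear_on_diff[OF f] by simp
  have "closed ?M"
    using bounded_clinear_on_continuous[OF f] by (intro closed_Collect_eq) auto
  moreover have "csubspace ?M"
    using bounded_clinear_on_zero[OF f]
    by (auto simp: complex_vector.subspace_def bounded_clinear_on_add[OF f] fs)
  ultimately have M: "hilbert_subspace ?M" by (simp add: hilbert_subspace_def)
  define u where "u = x - orth_proj ?M x"
  have u: "u \<in> orth_compl ?M" unfolding u_def by (rule orth_proj_diff[OF M])
  have fu: "f u \<noteq> 0" using orth_proj_in[OF M, of x] x by (simp add: u_def fd)
  then have "u \<noteq> 0" using bounded_clinear_on_zero[OF f] by auto
  then have uu: "cinner u u \<noteq> 0" by (simp add: cinner_self)
  \<comment> \<open>Subtracting (f z / f u) u moves z into the kernel of f, to which u is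
    orthogonal; solving for f z yields this multiple of u.\<close>
  have "f z = cinner z (cnj (f u / cinner u u) *\<^sub>C u)" for z
  proof -
    have "z - (f z / f u) *\<^sub>C u \<in> ?M" using fu by (simp add: fd fs)
    then have "cinner u (z - (f z / f u) *\<^sub>C u) = 0" using u by (simp add: orth_compl_def)
    then have "cinner (z - (f z / f u) *\<^sub>C u) u = 0" by (metis cinner_commute complex_cnj_zero)
    then have "cinner z u = f z / f u * cinner u u" by (simp add: cinner_diff_left cinner_scaleC_left)
    then show ?thesis using fu uu by (simp add: cinner_scaleC_right)
  qed
  then show ?thesis by blast
qed (auto intro: exI[of _ 0])

lemma cinner_eqI:
  assumes "\<And>z. cinner z x = cinner z y"
  shows "x = y"
proof -
  have "cinner (x - y) (x - y) = 0" using assms by (simp add: cinner_diff_right)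
  then show ?thesis by (simp add: cinner_self)
qed

text \<open>Riesz gives T y for each y separately; uniqueness of the representing vector makes T
  linear, and <T y, T y> = <G (T y), y> bounds it by the same constant as G.\<close>

lemma adjoint_exists:
  fixes G :: "'a::chilbert_space \<Rightarrow> 'b::chilbert_space"
  assumes G: "bounded_clinear_on UNIV UNIV G"
  shows "\<exists>T. bounded_clinear_on UNIV UNIV T \<and> (\<forall>x y. cinner (G x) y = cinner x (T y))"
proof -
  obtain C where C: "C > 0" "\<And>x. norm (G x) \<le> C * norm x"
    using bounded_clinear_on_bound[OF G] by auto
  have "\<exists>t. \<forall>x. cinner (G x) y = cinner x t" for y
  proof (rule riesz_representation, rule bounded_clinear_onI[where C = "C * norm y"])
    show "norm (cinner (G x) y) \<le> C * norm y * norm x" for x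
      using norm_cinner_le[of "G x" y] mult_right_mono[OF C(2), of "norm y" x]
      by (simp add: mult_ac)
  qed (simp_all add: bounded_clinear_on_add[OF G] bounded_clinear_on_scaleC[OF G] cinner_add_left
      cinner_scaleC_left scaleC_complex_def)
  then obtain T where T: "\<And>x y. cinner x (T y) = cinner (G x) y" by metis
  have "bounded_clinear_on UNIV UNIV T"
  proof (rule bounded_clinear_onI[where C = C])
    show "T (x + y) = T x + T y" for x y by (rule cinner_eqI) (simp add: cinner_add_right T)
    show "T (c *\<^sub>C x) = c *\<^sub>C T x" for c x by (rule cinner_eqI) (simp add: cinner_scaleC_right T)
    show "norm (T y) \<le> C * norm y" for y
    proof (cases "T y = 0")
      case False
      have "(norm (T y))\<^sup>2 = cmod (cinner (T y) (T y))" by (simp add: cinner_self norm_power)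
      also have "\<dots> \<le> norm (G (T y)) * norm y" unfolding T by (rule norm_cinner_le)
      also have "\<dots> \<le> C * norm (T y) * norm y" using C by (intro mult_right_mono) auto
      finally show ?thesis using False by (simp add: power2_eq_square)
    qed (use C in simp)
  qed simp
  then show ?thesis using T by metis
qed

section \<open>Projections, square roots of positive operators and polar decomposition\<close>

lemma orth_proj_id: "hilbert_subspace M \<Longrightarrow> x \<in> M \<Longrightarrow> orth_proj M x = x"
  by (rule orth_proj_eqI) (auto simp: orth_compl_def)

lemma orth_proj_selfadjoint:
  assumes "hilbert_subspace M"
  shows "cinner (orth_proj M x) y = cinner x (orth_proj M y)"
proof -
  have "cinner (x - orth_proj M x) (orth_proj M y) = 0" "cinner (y - orth_proj M y) (orth_proj M x) = 0"
    using orth_proj[OF assms] by (auto simp: orth_compl_def)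
  then show ?thesis
    by (metis cinner_commute cinner_diff_left complex_cnj_zero eq_iff_diff_eq_0)
qed

text \<open>The norm of a positive operator is controlled by its quadratic form. Polarization
  expresses 4 <S x, y> by the form at x + y and x - y; the second value is subtracted and
  nonnegative, so only the upper bound at x + y counts.\<close>

lemma positive_selfadjoint_norm_le:
  fixes S :: "'a::real_inner \<Rightarrow> 'a"
  assumes H: "subspace H" and lin: "linear S" and SH: "\<And>x. x \<in> H \<Longrightarrow> S x \<in> H"
    and sa: "\<And>x y. inner (S x) y = inner x (S y)"
    and pos: "\<And>x. x \<in> H \<Longrightarrow> 0 \<le> inner (S x) x"
    and le: "\<And>x. x \<in> H \<Longrightarrow> inner (S x) x \<le> r * (norm x)\<^sup>2" and r: "0 \<le> r" and x: "x \<in> H"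
  shows "norm (S x) \<le> r * norm x"
proof (cases "S x = 0")
  case False
  \<comment> \<open>The vector of length |x| in the direction of S x, chosen so that <S x, y> = |x|
    |S x|.\<close>
  define y where "y = (norm x / norm (S x)) *\<^sub>R S x"
  have y: "y \<in> H" unfolding y_def by (intro subspace_scale H SH x)
  have ny: "norm y = norm x" using False by (simp add: y_def)
  have "x \<noteq> 0" using False linear_0[OF lin] by auto
  have "4 * inner (S x) y = inner (S (x + y)) (x + y) - inner (S (x - y)) (x - y)"
    using sa[of x y] by (simp add: linear_add[OF lin] linear_diff[OF lin] inner_add_left inner_add_right
        inner_diff_left inner_diff_right inner_commute algebra_simps)
  also have "\<dots> \<le> inner (S (x + y)) (x + y)" using pos subspace_diff[OF H x y] by simp
  also have "\<dots> \<le> r * (norm (x + y))\<^sup>2" using le subspace_add[OF H x y] by simp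
  also have "\<dots> \<le> r * (2 * norm x)\<^sup>2"
    using norm_triangle_ineq[of x y] ny r by (intro mult_left_mono power_mono) auto
  finally have "inner (S x) y \<le> r * (norm x)\<^sup>2" by (simp add: power_mult_distrib)
  moreover have "inner (S x) y = norm x * norm (S x)"
    using False by (simp add: y_def power2_norm_eq_inner[symmetric] power2_eq_square)
  ultimately show ?thesis using \<open>x \<noteq> 0\<close> by (simp add: power2_eq_square mult_ac)
qed (use r in simp)

text \<open>A solution of \<open>2R = S + R\<^sup>2\<close> is a square root \<open>1 - R\<close> of \<open>1 - S\<close>; for \<open>\<parallel>S\<parallel> < 1\<close> it is the fixed
  point of a contraction, and it inherits every closed property preserved by the iteration.\<close>

lemma square_root_fixed_point:
  fixes S :: "'a::banach \<Rightarrow>\<^sub>L 'a"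
  assumes S: "norm S \<le> r" and r: "r < 1"
    and C: "closed {R. P R}" "P 0" "\<And>R. P R \<Longrightarrow> P ((1/2) *\<^sub>R (S + (R o\<^sub>L R)))"
  shows "\<exists>R. norm R \<le> r \<and> P R \<and> 2 *\<^sub>R R = S + (R o\<^sub>L R)"
proof -
  define F where "F = (\<lambda>R. (1/2) *\<^sub>R (S + (R o\<^sub>L R)))"
  \<comment> \<open>One number serves as radius and as contraction constant: F maps the ball into
    itself because (r + r^2)/2 \<le> r.\<close>
  let ?D = "{R. P R} \<inter> cball 0 r"
  have r0: "0 \<le> r" using S norm_ge_zero order_trans by blast
  have "\<exists>!R. R \<in> ?D \<and> F R = R"
  proof (rule Banach_fix[OF _ _ r0 r])
    show "complete ?D" using C(1) by (simp add: complete_eq_closed closed_Int)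
    show "?D \<noteq> {}" using C(2) r0 by auto
    show "F ` ?D \<subseteq> ?D"
    proof clarify
      fix R assume R: "P R" "R \<in> cball 0 r"
      have "norm (R o\<^sub>L R) \<le> r * r"
        using R norm_blinfun_compose[of R R] mult_mono[of "norm R" r "norm R" r] r0 by auto
      also have "\<dots> \<le> r" using r r0 mult_left_mono[of r 1 r] by simp
      finally have "norm (F R) \<le> r"
        using S norm_triangle_ineq[of S "R o\<^sub>L R"] by (simp add: F_def)
      then show "F R \<in> ?D" using C(3)[OF R(1)] by (simp add: F_def)
    qed
    show "dist (F R) (F Q) \<le> r * dist R Q" if "R \<in> ?D" "Q \<in> ?D" for R Q
    proof -
      \<comment> \<open>R^2 - Q^2 is split as R(R - Q) + (R - Q)Q, which holds for operators that do
        not commute; both terms have norm at most r |R - Q|.\<close>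
      have "F R - F Q = (1/2) *\<^sub>R ((R o\<^sub>L (R - Q)) + ((R - Q) o\<^sub>L Q))"
        by (rule blinfun_eqI) (simp add: F_def blinfun.bilinear_simps algebra_simps)
      then have "2 * norm (F R - F Q) \<le> norm (R o\<^sub>L (R - Q)) + norm ((R - Q) o\<^sub>L Q)"
        using norm_triangle_ineq by simp
      also have "\<dots> \<le> norm R * norm (R - Q) + norm (R - Q) * norm Q"
        by (intro add_mono norm_blinfun_compose)
      also have "\<dots> \<le> r * norm (R - Q) + norm (R - Q) * r"
        using that by (intro add_mono mult_right_mono mult_left_mono) auto
      finally show ?thesis by (simp add: dist_norm mult.commute)
    qed
  qed
  then obtain R where "P R" "norm R \<le> r" "F R = R" by auto
  moreover then have "2 *\<^sub>R R = S + (R o\<^sub>L R)"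
    by (metis (no_types, lifting) F_def scaleR_scaleR scaleR_one nonzero_divide_eq_eq
        times_divide_eq_right mult.right_neutral zero_neq_numeral)
  ultimately show ?thesis by blast
qed

text \<open>The square root is built among real-linear operators with the real inner product. The
  imaginary part of <x, y> is the real inner product of x with i y, so a complex-linear real
  isometry preserves the complex inner product.\<close>

lemma cinner_eq_of_inner_eq:
  assumes "\<And>x y. x \<in> M \<Longrightarrow> y \<in> M \<Longrightarrow> inner (U x) (U y) = inner x y" and "csubspace M"
    and "\<And>c x. x \<in> M \<Longrightarrow> U (c *\<^sub>C x) = c *\<^sub>C U x" and "x \<in> M" "y \<in> M"
  shows "cinner (U x) (U y) = cinner x y"
proof -
  have "\<i> *\<^sub>C y \<in> M" using assms by (simp add: complex_vector.subspace_scale)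
  then have "inner (U x) (\<i> *\<^sub>C U y) = inner x (\<i> *\<^sub>C y)" using assms by metis
  moreover have "inner (U x) (U y) = inner x y" using assms by blast
  ultimately show ?thesis by (simp add: inner_eq_Re_cinner cinner_scaleC_right complex_eq_iff)
qed

text \<open>The unitary part of the polar decomposition of \<open>A\<close>. After scaling, \<open>Q = (A\<^sup>*A)\<^sup>1\<^sup>/\<^sup>2\<close> on \<open>H\<close> is
  \<open>1 - R\<close> with \<open>R\<close> solving \<open>2R = S + R\<^sup>2\<close> for \<open>S = 1 - A\<^sup>*A\<close>, and \<open>U = A \<circ> Q\<^sup>-\<^sup>1\<close>.\<close>

lemma isometry_of_isomorphism:
  fixes A :: "'a::chilbert_space \<Rightarrow> 'b::chilbert_space"
  assumes H: "hilbert_subspace H"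
    and A: "bounded_clinear_on H H' A" and B: "bounded_clinear_on H' H B"
    and BA: "\<And>x. x \<in> H \<Longrightarrow> B (A x) = x" and AB: "\<And>y. y \<in> H' \<Longrightarrow> A (B y) = y"
  shows "\<exists>U. bounded_clinear_on H H' U \<and> bij_betw U H H' \<and>
             (\<forall>x\<in>H. \<forall>y\<in>H. cinner (U x) (U y) = cinner x y)"
proof -
  have subH: "csubspace H" and clH: "closed H" using H by (auto simp: hilbert_subspace_def)
  have rsub: "subspace H"
    using subH csubspace_scaleR[OF subH] by (auto simp: subspace_def complex_vector.subspace_def)
  define P where "P = orth_proj H"
  have PH: "P x \<in> H" for x unfolding P_def by (rule orth_proj_in[OF H])
  have Pid: "P x = x" if "x \<in> H" for x unfolding P_def by (rule orth_proj_id[OF H that])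
  have Psa: "cinner (P x) y = cinner x (P y)" for x y
    unfolding P_def by (rule orth_proj_selfadjoint[OF H])
  have Plin: "bounded_clinear_on UNIV H P"
    unfolding P_def by (rule bounded_clinear_on_orth_proj[OF H])
  have Pnorm: "norm (P x) \<le> norm x" for x
  proof -
    have "(norm (P x))\<^sup>2 = cmod (cinner (P x) (P x))" by (simp add: cinner_self norm_power)
    also have "\<dots> = cmod (cinner x (P x))" by (simp add: Psa Pid PH)
    also have "\<dots> \<le> norm x * norm (P x)" by (rule norm_cinner_le)
    finally show ?thesis by (cases "P x = 0") (simp_all add: power2_eq_square)
  qed

  \<comment> \<open>Precomposition with the projection makes A total, as the adjoint requires; G
    vanishes on the orthogonal complement of H.\<close>
  define G where "G = (\<lambda>x. A (P x))"
  have G: "bounded_clinear_on UNIV UNIV G"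
    unfolding G_def using bounded_clinear_on_compose[OF Plin A] by (rule bounded_clinear_on_mono) auto
  obtain G' where G': "bounded_clinear_on UNIV UNIV G'" and adj: "\<And>x y. cinner (G x) y = cinner x (G' y)"
    using adjoint_exists[OF G] by blast
  define T where "T = (\<lambda>x. G' (G x))"
  have T: "bounded_clinear_on UNIV UNIV T"
    unfolding T_def by (rule bounded_clinear_on_compose[OF G G'])
  have cT: "cinner x (T y) = cinner (G x) (G y)" for x y by (simp add: T_def adj)
  have cT': "cinner (T x) y = cinner (G x) (G y)" for x y
    by (metis cT cinner_commute)
  have GP: "G (P x) = G x" for x by (simp add: G_def Pid PH)
  have TP: "T (P x) = T x" for x by (simp add: T_def GP)
  \<comment> \<open>G P = G dualizes to P T = T, so T takes values in H.\<close>
  have TH: "T x \<in> H" for x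
  proof -
    have "P (T x) = T x"
      by (rule cinner_eqI) (simp add: Psa[symmetric] cT GP)
    then show ?thesis using PH by metis
  qed

  obtain a where a: "a > 0" "\<And>x. norm (G x) \<le> a * norm x"
    using bounded_clinear_on_bound[OF G] by auto
  obtain b where b: "b > 0" "\<And>y. y \<in> H' \<Longrightarrow> norm (B y) \<le> b * norm y"
    using bounded_clinear_on_bound[OF B] by auto
  \<comment> \<open>Scaling by 1/a makes e G a contraction, hence the form of S nonnegative on
    H.\<close>
  define e where "e = 1 / a"
  have e: "e > 0" using a by (simp add: e_def)
  \<comment> \<open>From |x| \<le> b |G x| on H, the form of S is at most (1 - (e/b)^2) |x|^2. The
    maximum with 0 covers H = {0}, where a and b are arbitrary and e/b may exceed 1.\<close>
  define r where "r = max 0 (1 - (e / b)\<^sup>2)"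
  have r: "0 \<le> r" "r < 1" using e b by (auto simp: r_def)
  \<comment> \<open>P stands in place of the identity so that S vanishes on the orthogonal
    complement of H; with the identity the norm of S would be 1 there and the contraction argument
    would fail.\<close>
  define S where "S = (\<lambda>x. P x - (e\<^sup>2) *\<^sub>R T x)"
  have lin: "bounded_linear S"
    unfolding S_def
    by (intro bounded_linear_sub bounded_linear_const_scaleR
        bounded_clinear_on_UNIV_bounded_linear[OF Plin] bounded_clinear_on_UNIV_bounded_linear[OF T])
  have SH: "S x \<in> H" for x
    unfolding S_def by (intro complex_vector.subspace_diff[OF subH] csubspace_scaleR[OF subH] PH TH)
  have Sc: "S (c *\<^sub>C x) = c *\<^sub>C S x" for c x
    unfolding S_def scaleC_of_real[symmetric]
    by (simp add: bounded_clinear_on_scaleC[OF Plin] bounded_clinear_on_scaleC[OF T]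
        complex_vector.scale_right_diff_distrib complex_vector.scale_left_commute)
  have Ssa: "inner (S x) y = inner x (S y)" for x y
    by (simp add: S_def inner_diff_left inner_diff_right) (simp add: inner_eq_Re_cinner Psa cT cT')
  have Sq: "inner (S x) x = (norm x)\<^sup>2 - (e * norm (G x))\<^sup>2" if "x \<in> H" for x
    using that by (simp add: S_def inner_diff_left Pid power2_norm_eq_inner)
      (simp add: inner_eq_Re_cinner cT' power_mult_distrib cinner_self)
  have SP: "S (P x) = S x" for x by (simp add: S_def TP Pid PH)
  have SHle: "norm (S x) \<le> r * norm x" if "x \<in> H" for x
  proof (rule positive_selfadjoint_norm_le[OF rsub bounded_linear.linear[OF lin] SH Ssa _ _ r(1) that])
    fix x assume x: "x \<in> H"
    have "e * norm (G x) \<le> norm x" using a by (simp add: e_def field_simps)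
    then have "(e * norm (G x))\<^sup>2 \<le> (norm x)\<^sup>2" using e by (intro power_mono) auto
    then show "0 \<le> inner (S x) x" by (simp add: Sq[OF x])
    have "norm x \<le> b * norm (G x)"
      using b(2)[of "A x"] bounded_clinear_on_in[OF A x] by (simp add: G_def Pid x BA)
    then have "e / b * norm x \<le> e * norm (G x)"
      using b(1) e by (simp add: field_simps)
    then have "(e / b * norm x)\<^sup>2 \<le> (e * norm (G x))\<^sup>2" using e b(1) by (intro power_mono) auto
    then have "inner (S x) x \<le> (1 - (e / b)\<^sup>2) * (norm x)\<^sup>2"
      unfolding power_mult_distrib[of "e / b"] by (simp add: Sq[OF x] left_diff_distrib)
    also have "\<dots> \<le> r * (norm x)\<^sup>2" by (intro mult_right_mono) (auto simp: r_def)
    finally show "inner (S x) x \<le> r * (norm x)\<^sup>2" .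
  qed
  have Sle: "norm (S x) \<le> r * norm x" for x
    using SHle[OF PH, of x] mult_left_mono[OF Pnorm r(1), of x] by (simp add: SP)

  \<comment> \<open>The closed properties carried through the iteration: complex linearity, which
    the type of R does not provide, self-adjointness and invariance of H.\<close>
  define good where "good = (\<lambda>R::'a \<Rightarrow>\<^sub>L 'a. (\<forall>c x. R (c *\<^sub>C x) = c *\<^sub>C R x) \<and>
    (\<forall>x y. inner (R x) y = inner x (R y)) \<and> (\<forall>x\<in>H. R x \<in> H))"
  have "closed {R. good R}"
  proof -
    have 1: "closed {R::'a \<Rightarrow>\<^sub>L 'a. R (c *\<^sub>C x) = c *\<^sub>C R x}" for c x
      by (intro closed_Collect_eq continuous_intros continuous_on_compose2[OF continuous_on_scaleC]) auto
    have 2: "closed {R::'a \<Rightarrow>\<^sub>L 'a. inner (R x) y = inner x (R y)}" for x y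
      by (intro closed_Collect_eq continuous_intros)
    have 3: "closed {R::'a \<Rightarrow>\<^sub>L 'a. R x \<in> H}" for x
      using closed_vimage[OF clH, of "\<lambda>R::'a \<Rightarrow>\<^sub>L 'a. R x"]
      by (simp add: vimage_def continuous_intros)
    have "{R. good R} = (\<Inter>c. \<Inter>x. {R::'a \<Rightarrow>\<^sub>L 'a. R (c *\<^sub>C x) = c *\<^sub>C R x}) \<inter>
        (\<Inter>x. \<Inter>y. {R::'a \<Rightarrow>\<^sub>L 'a. inner (R x) y = inner x (R y)}) \<inter> (\<Inter>x\<in>H. {R::'a \<Rightarrow>\<^sub>L 'a. R x \<in> H})"
      by (auto simp: good_def)
    then show ?thesis by (simp only:) (intro closed_Int closed_INT ballI 1 2 3)
  qed
  moreover have "good 0"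
    using complex_vector.subspace_0[OF subH] by (simp add: good_def)
  moreover have "good ((1/2) *\<^sub>R (Blinfun S + (R o\<^sub>L R)))" if R: "good R" for R
    using R unfolding good_def scaleC_of_real[symmetric]
    by (simp add: blinfun.bilinear_simps bounded_linear_Blinfun_apply[OF lin] SH Sc Ssa
        inner_add_left inner_add_right scaleC_add_right)
       (simp add: scaleC_of_real[symmetric] complex_vector.scale_left_commute scaleC_add_right
         complex_vector.subspace_add[OF subH] complex_vector.subspace_scale[OF subH] SH)
  moreover have "norm (Blinfun S) \<le> r"
    using Sle by (intro norm_blinfun_bound r(1)) (simp add: bounded_linear_Blinfun_apply[OF lin])
  ultimately obtain R where R: "norm R \<le> r" "good R" "2 *\<^sub>R R = Blinfun S + (R o\<^sub>L R)"
    using square_root_fixed_point[of "Blinfun S" r good] r(2) by blast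
  have Rc: "R (c *\<^sub>C x) = c *\<^sub>C R x" and Rsa: "inner (R x) y = inner x (R y)"
    and RH: "x \<in> H \<Longrightarrow> R x \<in> H" for c x y
    using R(2) by (auto simp: good_def)
  have Rle: "norm (R x) \<le> r * norm x" for x
    using norm_blinfun[of R x] mult_right_mono[OF R(1) norm_ge_zero, of x] by linarith

  \<comment> \<open>Expanding (1 - R)^2 with 2R = S + R^2 leaves 1 - S, which on H is e^2 T.\<close>
  define Q where "Q = (\<lambda>x. x - R x)"
  have QH: "Q x \<in> H" if "x \<in> H" for x
    unfolding Q_def by (intro complex_vector.subspace_diff[OF subH] RH that)
  have QQ: "Q (Q x) = (e\<^sup>2) *\<^sub>R T x" if "x \<in> H" for x
  proof -
    have "2 *\<^sub>R R x = S x + R (R x)"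
      using arg_cong[OF R(3), of "\<lambda>R. blinfun_apply R x"]
      by (simp add: blinfun.bilinear_simps bounded_linear_Blinfun_apply[OF lin])
    then show ?thesis
      using that by (simp add: Q_def blinfun.bilinear_simps S_def Pid scaleR_2 algebra_simps)
  qed
  have Qinner: "inner (Q x) (Q y) = inner (e *\<^sub>R A x) (e *\<^sub>R A y)" if "x \<in> H" "y \<in> H" for x y
  proof -
    have "inner (Q x) (Q y) = inner (Q (Q x)) y"
      by (simp add: Q_def inner_diff_left inner_diff_right Rsa blinfun.bilinear_simps)
    also have "\<dots> = (e\<^sup>2) * inner (G x) (G y)" using that by (simp add: QQ inner_eq_Re_cinner[of "T x"] cT')
      (simp add: inner_eq_Re_cinner)
    finally show ?thesis using that by (simp add: G_def Pid power2_eq_square)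
  qed
  have low: "(1 - r) * norm x \<le> norm (Q x)" for x
    using norm_triangle_ineq2[of x "R x"] Rle[of x] by (simp add: Q_def algebra_simps)
  have Qlin: "bounded_clinear_on H H Q"
  proof (rule bounded_clinear_onI[where C = "1 + r"])
    show "norm (Q x) \<le> (1 + r) * norm x" for x
      using norm_triangle_ineq4[of x "R x"] Rle[of x] by (simp add: Q_def algebra_simps)
  qed (simp_all add: QH, simp_all add: Q_def blinfun.bilinear_simps Rc complex_vector.scale_right_diff_distrib)
  have "inj_on Q H"
  proof (rule inj_onI)
    fix x y assume xy: "x \<in> H" "y \<in> H" "Q x = Q y"
    then have "Q (x - y) = 0" using bounded_clinear_on_diff[OF Qlin subH] by simp
    then have "(1 - r) * norm (x - y) \<le> 0" using low[of "x - y"] by simp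
    then show "x = y" using r(2) by (simp add: mult_le_0_iff)
  qed
  moreover have "\<exists>x\<in>H. Q x = y" if y: "y \<in> H" for y
  proof -
    \<comment> \<open>Q x = y is the fixed point equation x = y + R x; R contracts by r and keeps
      the complete set H invariant.\<close>
    have "\<exists>!x\<in>H. y + R x = x"
    proof (rule Banach_fix[OF _ _ r])
      show "complete H" using clH by (simp add: complete_eq_closed)
      show "H \<noteq> {}" using y by auto
      show "(\<lambda>x. y + R x) ` H \<subseteq> H" using y RH complex_vector.subspace_add[OF subH] by auto
      show "dist (y + R x) (y + R z) \<le> r * dist x z" for x z
        using Rle[of "x - z"] by (simp add: dist_norm blinfun.bilinear_simps)
    qed
    then show ?thesis unfolding Q_def by (metis add_diff_cancel_right')
  qed
  ultimately have Qbij: "bij_betw Q H H" using QH by (auto simp: bij_betw_def)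

  define Z where "Z = inv_into H Q"
  have Zlin: "bounded_clinear_on H H Z"
    unfolding Z_def
  proof (rule bounded_clinear_on_inv_into[OF Qlin subH Qbij])
    show "norm x \<le> 1 / (1 - r) * norm (Q x)" for x using low[of x] r(2) by (simp add: field_simps)
  qed
  have ZH: "Z y \<in> H" and QZ: "Q (Z y) = y" if "y \<in> H" for y
    using that Qbij unfolding Z_def by (auto simp: bij_betw_def inv_into_into f_inv_into_f)
  have ZQ: "Z (Q x) = x" if "x \<in> H" for x
    using that Qbij unfolding Z_def by (auto simp: bij_betw_def)
  \<comment> \<open>Q and e A have the same inner products on H, so Q x |-> e A x is isometric.
    Placing e inside as a complex scalar makes U a composition of bounded complex-linear
    maps.\<close>
  define U where "U = (\<lambda>y. A (Z (of_real e *\<^sub>C y)))"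
  have Ulin: "bounded_clinear_on H H' U"
  proof -
    have "bounded_clinear_on H H (\<lambda>y. of_real e *\<^sub>C y)"
      by (rule bounded_clinear_onI[where C = e])
         (use e in \<open>simp_all add: complex_vector.subspace_scale[OF subH] scaleC_add_right
           complex_vector.scale_left_commute norm_scaleC\<close>)
    from bounded_clinear_on_compose[OF bounded_clinear_on_compose[OF this Zlin] A]
    show ?thesis by (simp add: U_def)
  qed
  have U: "U y = e *\<^sub>R A (Z y)" if "y \<in> H" for y
    unfolding U_def scaleC_of_real[symmetric]
    using that by (simp add: bounded_clinear_on_scaleC[OF Zlin] bounded_clinear_on_scaleC[OF A] ZH)
  have Uinner: "cinner (U x) (U y) = cinner x y" if "x \<in> H" "y \<in> H" for x y
  proof (rule cinner_eq_of_inner_eq[OF _ subH bounded_clinear_on_scaleC[OF Ulin] that])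
    show "inner (U x) (U y) = inner x y" if "x \<in> H" "y \<in> H" for x y
      using Qinner[of "Z x" "Z y"] that by (simp add: U ZH QZ)
  qed
  have "bij_betw U H H'"
  proof (rule bij_betw_byWitness[where f' = "\<lambda>z. inverse e *\<^sub>R Q (B z)"])
    show "\<forall>x\<in>H. inverse e *\<^sub>R Q (B (U x)) = x"
      using e by (simp add: U_def BA ZH complex_vector.subspace_scale[OF subH] QZ) (simp add: scaleC_of_real)
    have BH: "B z \<in> H" if "z \<in> H'" for z using bounded_clinear_on_in[OF B that] .
    show "\<forall>z\<in>H'. U (inverse e *\<^sub>R Q (B z)) = z"
      using e by (simp add: U_def scaleC_of_real BH QH ZQ AB)
    show "U ` H \<subseteq> H'" using bounded_clinear_on_in[OF Ulin] by blast
    show "(\<lambda>z. inverse e *\<^sub>R Q (B z)) ` H' \<subseteq> H" using BH QH csubspace_scaleR[OF subH] by blast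
  qed
  then show ?thesis using Ulin Uinner by blast
qed


section \<open>Similarity and unitary equivalence of tuples\<close>

text \<open>Lets an explicit two-sided inverse stand for \<open>inv_into\<close>, so that symmetry
  and transitivity become computations with pairs of maps.\<close>

lemma similar_tuplesI:
  assumes X: "bounded_clinear_on K K' X" and Y: "bounded_clinear_on K' K Y" and K': "csubspace K'"
    and YX: "\<And>x. x \<in> K \<Longrightarrow> Y (X x) = x" and XY: "\<And>y. y \<in> K' \<Longrightarrow> X (Y y) = y"
    and VX: "\<And>i x. x \<in> K \<Longrightarrow> X (V i x) = V' i (X x)"
  shows "similar_tuples K V K' V'"
proof -
  have bij: "bij_betw X K K'"
    using bounded_clinear_on_in[OF X] bounded_clinear_on_in[OF Y] YX XY
    by (intro bij_betw_byWitness[where f' = Y]) auto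
  have "inv_into K X y = Y y" if "y \<in> K'" for y
    using that bij XY bounded_clinear_on_in[OF Y] by (intro inv_into_f_eq) (auto simp: bij_betw_def)
  then have "bounded_clinear_on K' K (inv_into K X)"
    by (intro bounded_clinear_on_cong[OF Y K'])
  then show ?thesis using X bij VX unfolding similar_tuples_def by blast
qed

lemma similar_tuplesE:
  assumes "similar_tuples K V K' V'"
  obtains X Y where "bounded_clinear_on K K' X" "bounded_clinear_on K' K Y"
    "\<And>x. x \<in> K \<Longrightarrow> Y (X x) = x" "\<And>y. y \<in> K' \<Longrightarrow> X (Y y) = y"
    "\<And>i x. x \<in> K \<Longrightarrow> X (V i x) = V' i (X x)"
proof -
  obtain X where X: "bounded_clinear_on K K' X" "bij_betw X K K'"
      "bounded_clinear_on K' K (inv_into K X)" "\<And>i x. x \<in> K \<Longrightarrow> X (V i x) = V' i (X x)"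
    using assms unfolding similar_tuples_def by blast
  then show ?thesis
    by (intro that[of X "inv_into K X"]) (auto simp: bij_betw_def f_inv_into_f)
qed

text \<open>Similarity by itself does not say that \<open>V i\<close> maps K into K. The invariance
  is assumed here because Y X = 1 is applied at \<open>V i (Y y)\<close>.\<close>

lemma similar_tuples_sym:
  assumes "similar_tuples K V K' V'" and K: "csubspace K" and V: "\<And>i x. x \<in> K \<Longrightarrow> V i x \<in> K"
  shows "similar_tuples K' V' K V"
proof -
  obtain X Y where X: "bounded_clinear_on K K' X" and Y: "bounded_clinear_on K' K Y"
    and YX: "\<And>x. x \<in> K \<Longrightarrow> Y (X x) = x" and XY: "\<And>y. y \<in> K' \<Longrightarrow> X (Y y) = y"
    and VX: "\<And>i x. x \<in> K \<Longrightarrow> X (V i x) = V' i (X x)"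
    using similar_tuplesE[OF assms(1)] by metis
  have "Y (V' i y) = V i (Y y)" if "y \<in> K'" for i y
  proof -
    have y: "Y y \<in> K" using bounded_clinear_on_in[OF Y that] .
    have "V' i y = X (V i (Y y))" by (simp add: VX y XY that)
    then show ?thesis by (simp add: YX V y)
  qed
  then show ?thesis by (intro similar_tuplesI[OF Y X K XY YX])
qed

lemma similar_tuples_trans:
  assumes "similar_tuples K V K' V'" "similar_tuples K' V' K'' V''" and "csubspace K''"
  shows "similar_tuples K V K'' V''"
proof -
  obtain X Y where X: "bounded_clinear_on K K' X" and Y: "bounded_clinear_on K' K Y"
    and YX: "\<And>x. x \<in> K \<Longrightarrow> Y (X x) = x" and XY: "\<And>y. y \<in> K' \<Longrightarrow> X (Y y) = y"
    and VX: "\<And>i x. x \<in> K \<Longrightarrow> X (V i x) = V' i (X x)"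
    using similar_tuplesE[OF assms(1)] by metis
  obtain X' Y' where X': "bounded_clinear_on K' K'' X'" and Y': "bounded_clinear_on K'' K' Y'"
    and YX': "\<And>x. x \<in> K' \<Longrightarrow> Y' (X' x) = x" and XY': "\<And>y. y \<in> K'' \<Longrightarrow> X' (Y' y) = y"
    and VX': "\<And>i x. x \<in> K' \<Longrightarrow> X' (V' i x) = V'' i (X' x)"
    using similar_tuplesE[OF assms(2)] by metis
  show ?thesis
    by (rule similar_tuplesI[OF bounded_clinear_on_compose[OF X X'] bounded_clinear_on_compose[OF Y' Y] assms(3)])
       (simp_all add: YX XY VX YX' XY' VX' bounded_clinear_on_in[OF X] bounded_clinear_on_in[OF Y'])
qed

lemma unitarily_equivalent_tuplesE:
  assumes "unitarily_equivalent_tuples K V K' V'" and K: "csubspace K"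
  obtains U Y where "bounded_clinear_on K K' U" "bounded_clinear_on K' K Y"
    "\<And>x. x \<in> K \<Longrightarrow> Y (U x) = x" "\<And>y. y \<in> K' \<Longrightarrow> U (Y y) = y"
    "\<And>i x. x \<in> K \<Longrightarrow> U (V i x) = V' i (U x)"
    "\<And>x y. x \<in> K \<Longrightarrow> y \<in> K \<Longrightarrow> cinner (U x) (U y) = cinner x y"
proof -
  obtain U where U: "bounded_clinear_on K K' U" "bij_betw U K K'"
    and VU: "\<And>i x. x \<in> K \<Longrightarrow> U (V i x) = V' i (U x)"
    and iso: "\<And>x y. x \<in> K \<Longrightarrow> y \<in> K \<Longrightarrow> cinner (U x) (U y) = cinner x y"
    using assms(1) unfolding unitarily_equivalent_tuples_def by blast
  have "norm x \<le> 1 * norm (U x)" if "x \<in> K" for x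
    using iso[OF that that] by (simp add: norm_eq_sqrt_inner inner_eq_Re_cinner)
  from bounded_clinear_on_inv_into[OF U(1) K U(2) this]
  show ?thesis
    using U VU iso by (intro that[of U "inv_into K U"]) (auto simp: bij_betw_def f_inv_into_f)
qed

lemma unitarily_equivalent_tuplesI:
  assumes U: "bounded_clinear_on K K' U" and Y: "\<And>y. y \<in> K' \<Longrightarrow> Y y \<in> K"
    and YU: "\<And>x. x \<in> K \<Longrightarrow> Y (U x) = x" and UY: "\<And>y. y \<in> K' \<Longrightarrow> U (Y y) = y"
    and VU: "\<And>i x. x \<in> K \<Longrightarrow> U (V i x) = V' i (U x)"
    and iso: "\<And>x y. x \<in> K \<Longrightarrow> y \<in> K \<Longrightarrow> cinner (U x) (U y) = cinner x y"
  shows "unitarily_equivalent_tuples K V K' V'"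
proof -
  have "bij_betw U K K'"
    using bounded_clinear_on_in[OF U] Y YU UY by (intro bij_betw_byWitness[where f' = Y]) auto
  then show ?thesis using U VU iso unfolding unitarily_equivalent_tuples_def by blast
qed

lemma unitarily_equivalent_imp_similar:
  assumes "unitarily_equivalent_tuples K V K' V'" "csubspace K" "csubspace K'"
  shows "similar_tuples K V K' V'"
  by (rule unitarily_equivalent_tuplesE[OF assms(1,2)], rule similar_tuplesI[OF _ _ assms(3)])

lemma unitarily_equivalent_tuples_sym:
  assumes "unitarily_equivalent_tuples K V K' V'" and K: "csubspace K"
    and V: "\<And>i x. x \<in> K \<Longrightarrow> V i x \<in> K"
  shows "unitarily_equivalent_tuples K' V' K V"
proof -
  obtain U Y where U: "bounded_clinear_on K K' U" and Y: "bounded_clinear_on K' K Y"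
    and YU: "\<And>x. x \<in> K \<Longrightarrow> Y (U x) = x" and UY: "\<And>y. y \<in> K' \<Longrightarrow> U (Y y) = y"
    and VU: "\<And>i x. x \<in> K \<Longrightarrow> U (V i x) = V' i (U x)"
    and iso: "\<And>x y. x \<in> K \<Longrightarrow> y \<in> K \<Longrightarrow> cinner (U x) (U y) = cinner x y"
    using unitarily_equivalent_tuplesE[OF assms(1,2)] by metis
  note Y_in = bounded_clinear_on_in[OF Y]
  show ?thesis
  proof (rule unitarily_equivalent_tuplesI[OF Y bounded_clinear_on_in[OF U] UY YU])
    show "Y (V' i y) = V i (Y y)" if "y \<in> K'" for i y
    proof -
      have "V' i y = U (V i (Y y))" by (simp add: VU Y_in UY that)
      then show ?thesis by (simp add: YU V Y_in that)
    qed
    show "cinner (Y x) (Y y) = cinner x y" if "x \<in> K'" "y \<in> K'" for x y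
      using iso[of "Y x" "Y y"] that by (simp add: Y_in UY)
  qed
qed

lemma unitarily_equivalent_tuples_trans:
  assumes "unitarily_equivalent_tuples K V K' V'" "unitarily_equivalent_tuples K' V' K'' V''"
    and "csubspace K" "csubspace K'"
  shows "unitarily_equivalent_tuples K V K'' V''"
proof -
  obtain X Y where X: "bounded_clinear_on K K' X" and Y: "bounded_clinear_on K' K Y"
    and YX: "\<And>x. x \<in> K \<Longrightarrow> Y (X x) = x" and XY: "\<And>y. y \<in> K' \<Longrightarrow> X (Y y) = y"
    and VX: "\<And>i x. x \<in> K \<Longrightarrow> X (V i x) = V' i (X x)"
    and iso: "\<And>x y. x \<in> K \<Longrightarrow> y \<in> K \<Longrightarrow> cinner (X x) (X y) = cinner x y"
    using unitarily_equivalent_tuplesE[OF assms(1,3)] by metis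
  obtain X' Y' where X': "bounded_clinear_on K' K'' X'" and Y': "bounded_clinear_on K'' K' Y'"
    and YX': "\<And>x. x \<in> K' \<Longrightarrow> Y' (X' x) = x" and XY': "\<And>y. y \<in> K'' \<Longrightarrow> X' (Y' y) = y"
    and VX': "\<And>i x. x \<in> K' \<Longrightarrow> X' (V' i x) = V'' i (X' x)"
    and iso': "\<And>x y. x \<in> K' \<Longrightarrow> y \<in> K' \<Longrightarrow> cinner (X' x) (X' y) = cinner x y"
    using unitarily_equivalent_tuplesE[OF assms(2,4)] by metis
  show ?thesis
    by (rule unitarily_equivalent_tuplesI[OF bounded_clinear_on_compose[OF X X'],
          where Y = "\<lambda>y. Y (Y' y)"])
       (simp_all add: YX XY VX YX' XY' VX' iso iso' bounded_clinear_on_in[OF X] bounded_clinear_on_in[OF Y]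
          bounded_clinear_on_in[OF Y'])
qed

section \<open>Constrained shifts\<close>

lemma ell2_apply_sum: "ell2_apply (\<Sum>i\<in>I. f i) w = (\<Sum>i\<in>I. ell2_apply (f i) w)"
  by (induction I rule: infinite_finite_induct) auto

lemma bounded_clinear_on_ell2_apply: "bounded_clinear_on UNIV UNIV (\<lambda>f. ell2_apply f w)"
  by (rule bounded_clinear_onI[where C = 1]) (simp_all add: norm_ell2_apply_le)

text \<open>Guarantees that the vacuum component of a vector of N \<otimes> H lies in H itself, not
  just in the ambient type. Evaluation at a word is bounded, so elementary tensors suffice.\<close>

lemma tensor_space_values:
  assumes H: "hilbert_subspace H" and f: "f \<in> tensor_space N H"
  shows "ell2_apply f w \<in> H"
  using f unfolding tensor_space_def
  by (rule bounded_clinear_on_closure_cspan_in[OF bounded_clinear_on_ell2_apply H, rotated])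
     (use H in \<open>auto simp: tensor_apply hilbert_subspace_def complex_vector.subspace_scale\<close>)

lemma vacuum_apply: "ell2_apply (vacuum :: 'n fock) w = (if w = [] then 1 else 0)"
proof -
  have "(\<lambda>w::'n list. (norm (if w = [] then 1 else 0 :: complex))\<^sup>2) summable_on UNIV"
    by (rule summable_on_cong_neutral[where T = "{[]}", THEN iffD2]) auto
  then show ?thesis unfolding vacuum_def by (subst Abs_ell2_inverse) auto
qed

lemma bounded_clinear_on_tensor: "bounded_clinear_on UNIV UNIV (tensor \<phi> :: 'h::chilbert_space \<Rightarrow> _)"
proof (rule bounded_clinear_onI[where C = "norm \<phi>"])
  show "norm (tensor \<phi> h) \<le> norm \<phi> * norm h" for h :: 'h
  proof -
    have "(norm (tensor \<phi> h))\<^sup>2 = (norm \<phi> * norm h)\<^sup>2"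
      using cinner_tensor[of \<phi> h \<phi> h] unfolding cinner_self of_real_mult[symmetric] of_real_eq_iff
      by (simp add: power_mult_distrib)
    then show ?thesis by simp
  qed
qed (auto intro!: ell2_eqI simp: tensor_apply scaleC_add_right complex_vector.scale_left_commute)

section \<open>Backward shifts and co-invariance of N\<close>

text \<open>The adjoint of \<open>left_creation i\<close>.\<close>

definition left_annihilation :: "'n \<Rightarrow> ('n list, 'a::chilbert_space) ell2 \<Rightarrow> ('n list, 'a) ell2" where
  "left_annihilation i f = Abs_ell2 (\<lambda>w. ell2_apply f (i # w))"

lemma
  shows left_annihilation_apply: "ell2_apply (left_annihilation i f) w = ell2_apply f (i # w)"
    and norm_left_annihilation_le: "norm (left_annihilation i f) \<le> norm f"
proof -
  have bd: "(\<Sum>w\<in>F. (norm (ell2_apply f (i # w)))\<^sup>2) \<le> (norm f)\<^sup>2" if "finite F" for F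
    using sum_le_norm_ell2[of "Cons i ` F" f] that by (simp add: sum.reindex)
  note * = ell2_boundedI[OF bd norm_ge_zero]
  show "ell2_apply (left_annihilation i f) w = ell2_apply f (i # w)"
    unfolding left_annihilation_def by (subst Abs_ell2_inverse) (use *(1) in auto)
  show "norm (left_annihilation i f) \<le> norm f"
    unfolding left_annihilation_def by (rule *(2))
qed

lemma bounded_clinear_on_left_annihilation: "bounded_clinear_on UNIV UNIV (left_annihilation i)"
  by (rule bounded_clinear_onI[where C = 1])
     (auto intro!: ell2_eqI simp: left_annihilation_apply norm_left_annihilation_le)

lemma left_annihilation_adjoint: "cinner (left_annihilation i f) g = cinner f (left_creation i g)"
proof -
  have "cinner f (left_creation i g)
      = (\<Sum>\<^sub>\<infinity>w\<in>range (Cons i). cinner (ell2_apply f w) (ell2_apply (left_creation i g) w))"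
    unfolding cinner_ell2_def
    by (rule infsum_cong_neutral) (auto simp: left_creation_apply split: list.splits)
  also have "\<dots> = cinner (left_annihilation i f) g"
    unfolding cinner_ell2_def
    by (subst infsum_reindex) (auto simp: inj_on_def o_def left_creation_apply left_annihilation_apply)
  finally show ?thesis by simp
qed

text \<open>Membership in N can thus be tested on single vectors T \<psi> with T in J.\<close>

lemma orth_compl_closure_cspan: "orth_compl (closure (cspan G)) = orth_compl G"
proof
  show "orth_compl (closure (cspan G)) \<subseteq> orth_compl G"
    using closure_subset[of "cspan G"] complex_vector.span_superset[of G]
    unfolding orth_compl_def by blast
  show "orth_compl G \<subseteq> orth_compl (closure (cspan G))"
  proof
    fix x assume x: "x \<in> orth_compl G"
    then have "cspan G \<subseteq> {y. cinner x y = 0}"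
      by (intro complex_vector.span_minimal csubspace_orth_vec) (auto simp: orth_compl_def)
    then have "closure (cspan G) \<subseteq> {y. cinner x y = 0}"
      by (intro closure_minimal closed_orth_vec)
    then show "x \<in> orth_compl (closure (cspan G))" by (auto simp: orth_compl_def)
  qed
qed

text \<open>Pairing with T \<psi> moves the annihilation operator across as S_i, and S_i T is again
  in J.\<close>

lemma left_annihilation_N_space:
  assumes J: "wot_closed_ideal J" and \<phi>: "\<phi> \<in> N_space J"
  shows "left_annihilation i \<phi> \<in> N_space J"
proof -
  have "left_creation i \<in> F_infinity"
    unfolding F_infinity_def by (rule hull_subset[THEN subsetD]) auto
  then have "left_creation i \<circ> T \<in> J" if "T \<in> J" for T
    using J that unfolding wot_closed_ideal_def by blast
  moreover have "cinner \<phi> (T \<psi>) = 0" if "T \<in> J" for T \<psi>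
    using \<phi>[unfolded N_space_def orth_compl_closure_cspan] that by (auto simp: orth_compl_def)
  ultimately have "cinner \<phi> (left_creation i (T \<psi>)) = 0" if "T \<in> J" for T \<psi>
    using that by (metis comp_apply)
  then show ?thesis
    unfolding N_space_def orth_compl_closure_cspan
    by (auto simp: orth_compl_def left_annihilation_adjoint)
qed

lemma left_annihilation_tensor_space:
  fixes H :: "'h::chilbert_space set"
  assumes J: "wot_closed_ideal J" and f: "f \<in> tensor_space (N_space J) H"
  shows "left_annihilation i f \<in> tensor_space (N_space J) H"
proof -
  have "left_annihilation i (tensor \<phi> h) = tensor (left_annihilation i \<phi>) h" for \<phi> and h :: 'h
    by (rule ell2_eqI) (simp add: tensor_apply left_annihilation_apply)
  then show ?thesis
    by (intro bounded_clinear_on_closure_cspan_in[OF bounded_clinear_on_left_annihilation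
          hilbert_subspace_tensor_space _ f[unfolded tensor_space_def]])
       (auto intro!: tensor_in_tensor_space left_annihilation_N_space[OF J])
qed

section \<open>The vacuum component of the compressed shifts\<close>

text \<open>\<open>ampliation\<close> is an arbitrary choice; its values on elementary tensors and
  density identify it with the compression of S_i \<otimes> I.\<close>

lemma ampliation_eq:
  assumes "f \<in> tensor_space (N_space J) H"
  shows "ampliation (N_space J) H (B_shift J i) f
           = orth_proj (tensor_space (N_space J) H) (left_creation i f)"
proof -
  note 1 = is_ampliation_ampliation[of J H i, unfolded is_ampliation_def]
  note 2 = is_ampliation_B_shift[of J H i, unfolded is_ampliation_def]
  show ?thesis
    by (rule bounded_clinear_on_closure_cspan_eq[OF 1[THEN conjunct1, unfolded tensor_space_def]
          2[THEN conjunct1, unfolded tensor_space_def], folded tensor_space_def])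
       (use 1 2 assms in auto)
qed

lemma bounded_clinear_on_ampliation:
  "bounded_clinear_on (tensor_space (N_space J) H) (tensor_space (N_space J) H)
     (ampliation (N_space J) H (B_shift J i))"
  using is_ampliation_ampliation[of J H i] unfolding is_ampliation_def by blast

lemma ampliation_in:
  "f \<in> tensor_space (N_space J) H \<Longrightarrow> ampliation (N_space J) H (B_shift J i) f \<in> tensor_space (N_space J) H"
  by (rule bounded_clinear_on_in[OF bounded_clinear_on_ampliation])

lemma ampliation_tensor:
  assumes "\<phi> \<in> N_space J" "h \<in> H"
  shows "ampliation (N_space J) H (B_shift J i) (tensor \<phi> h) = tensor (B_shift J i \<phi>) h"
  using is_ampliation_ampliation[of J H i] assms unfolding is_ampliation_def by blast

text \<open>S_i f has no vacuum component, and compressing changes it only by a vector orthogonal to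
  N \<otimes> H, hence to 1 \<otimes> H.\<close>

lemma vacuum_component_ampliation:
  fixes J :: "('n fock \<Rightarrow> 'n fock) set" and H :: "'h::chilbert_space set"
  assumes H: "hilbert_subspace H" and vac: "vacuum \<in> N_space J"
    and f: "f \<in> tensor_space (N_space J) H"
  shows "ell2_apply (ampliation (N_space J) H (B_shift J i) f) [] = 0"
proof -
  let ?M = "tensor_space (N_space J) H" and ?W = "ampliation (N_space J) H (B_shift J i)"
  have vac_cinner: "cinner g (tensor vacuum h) = cinner (ell2_apply g []) h"
    for g :: "('n list, 'h) ell2" and h
  proof -
    have "cinner g (tensor vacuum h)
        = (\<Sum>\<^sub>\<infinity>w\<in>{[]}. cinner (ell2_apply g w) (ell2_apply (tensor vacuum h) w))"
      unfolding cinner_ell2_def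
      by (rule infsum_cong_neutral) (auto simp: tensor_apply vacuum_apply)
    then show ?thesis by (simp add: tensor_apply vacuum_apply)
  qed
  \<comment> \<open>Testing against 1 \<otimes> h with h the component itself gives <h, h> =
    0.\<close>
  let ?h = "ell2_apply (?W f) []"
  have "?W f \<in> ?M" using bounded_clinear_on_in[OF bounded_clinear_on_ampliation f] .
  then have h: "?h \<in> H" by (rule tensor_space_values[OF H])
  have "left_creation i f - ?W f \<in> orth_compl ?M"
    unfolding ampliation_eq[OF f] by (rule orth_proj_diff[OF hilbert_subspace_tensor_space])
  then have "cinner (left_creation i f - ?W f) (tensor vacuum ?h) = 0"
    using tensor_in_tensor_space[OF vac h] by (simp add: orth_compl_def)
  then have "cinner ?h ?h = 0"
    by (simp add: vac_cinner left_creation_apply cinner_minus_left)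
  then show ?thesis by (simp add: cinner_self)
qed

text \<open>Sorting words by their first letter gives the decomposition with
  \<open>left_creation\<close>. Projecting onto N \<otimes> H fixes f and the vacuum term and turns
  creation operators into the shifts.\<close>

lemma vacuum_decomposition:
  fixes J :: "('n::finite fock \<Rightarrow> 'n fock) set"
  assumes J: "wot_closed_ideal J" and vac: "vacuum \<in> N_space J" and H: "hilbert_subspace H"
    and f: "f \<in> tensor_space (N_space J) H"
  shows "f = tensor vacuum (ell2_apply f []) +
    (\<Sum>i\<in>UNIV. ampliation (N_space J) H (B_shift J i) (left_annihilation i f))"
proof -
  let ?M = "tensor_space (N_space J) H" and ?P = "orth_proj (tensor_space (N_space J) H)"
  note M = hilbert_subspace_tensor_space[of "N_space J" H]
  note P = bounded_clinear_on_orth_proj[OF M]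
  have "f = tensor vacuum (ell2_apply f []) + (\<Sum>i\<in>UNIV. left_creation i (left_annihilation i f))"
  proof (rule ell2_eqI)
    fix w
    show "ell2_apply f w = ell2_apply (tensor vacuum (ell2_apply f []) +
        (\<Sum>i\<in>UNIV. left_creation i (left_annihilation i f))) w"
      by (cases w) (simp_all add: ell2_apply_sum tensor_apply vacuum_apply left_creation_apply
          left_annihilation_apply)
  qed
  then have "?P f = ?P (tensor vacuum (ell2_apply f []) + (\<Sum>i\<in>UNIV. left_creation i (left_annihilation i f)))"
    by simp
  also have "\<dots> = ?P (tensor vacuum (ell2_apply f [])) + (\<Sum>i\<in>UNIV. ?P (left_creation i (left_annihilation i f)))"
    by (simp add: bounded_clinear_on_add[OF P] bounded_clinear_on_sum[OF P])
  also have "?P (tensor vacuum (ell2_apply f [])) = tensor vacuum (ell2_apply f [])"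
    by (intro orth_proj_id[OF M] tensor_in_tensor_space vac tensor_space_values[OF H f])
  also have "?P f = f" by (rule orth_proj_id[OF M f])
  finally show ?thesis by (simp add: ampliation_eq left_annihilation_tensor_space[OF J f])
qed

section \<open>From similar shifts to isomorphic coefficient spaces\<close>

text \<open>Only one of the two inverse identities; the other follows by exchanging X with Y and H
  with H'.\<close>

lemma similar_ampliations_cancel:
  fixes J :: "('n::finite fock \<Rightarrow> 'n fock) set" and H :: "'a::chilbert_space set" and H' :: "'b::chilbert_space set"
  assumes J: "wot_closed_ideal J" and vac: "vacuum \<in> N_space J"
    and H: "hilbert_subspace H" and H': "hilbert_subspace H'"
    and X: "bounded_clinear_on (tensor_space (N_space J) H) (tensor_space (N_space J) H') X"
    and Y: "bounded_clinear_on (tensor_space (N_space J) H') (tensor_space (N_space J) H) Y"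
    and YX: "\<And>f. f \<in> tensor_space (N_space J) H \<Longrightarrow> Y (X f) = f"
    and WY: "\<And>i f. f \<in> tensor_space (N_space J) H' \<Longrightarrow>
      Y (ampliation (N_space J) H' (B_shift J i) f) = ampliation (N_space J) H (B_shift J i) (Y f)"
    and h: "h \<in> H"
  shows "ell2_apply (Y (tensor vacuum (ell2_apply (X (tensor vacuum h)) []))) [] = h"
proof -
  let ?M = "tensor_space (N_space J) H" and ?M' = "tensor_space (N_space J) H'"
  let ?W = "\<lambda>i. ampliation (N_space J) H (B_shift J i)" and ?W' = "\<lambda>i. ampliation (N_space J) H' (B_shift J i)"
  define g where "g = X (tensor vacuum h)"
  have th: "tensor vacuum h \<in> ?M" by (intro tensor_in_tensor_space vac h)
  have g: "g \<in> ?M'" unfolding g_def by (rule bounded_clinear_on_in[OF X th])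
  have M': "csubspace ?M'" using hilbert_subspace_tensor_space[of "N_space J" H'] by (simp add: hilbert_subspace_def)
  have t: "tensor vacuum (ell2_apply g []) \<in> ?M'"
    by (intro tensor_in_tensor_space vac tensor_space_values[OF H' g])
  have L: "left_annihilation i g \<in> ?M'" for i by (rule left_annihilation_tensor_space[OF J g])
  have W': "?W' i (left_annihilation i g) \<in> ?M'" for i
    by (rule bounded_clinear_on_in[OF bounded_clinear_on_ampliation L])
  have "tensor vacuum h = Y g" by (simp add: g_def YX th)
  \<comment> \<open>Splitting g isolates its vacuum part; Y carries the other terms to values of the
    shifts over H, which vanish at the empty word.\<close>
  also have "\<dots> = Y (tensor vacuum (ell2_apply g []) + (\<Sum>i\<in>UNIV. ?W' i (left_annihilation i g)))"
    using vacuum_decomposition[OF J vac H' g] by simp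
  also have "\<dots> = Y (tensor vacuum (ell2_apply g [])) + (\<Sum>i\<in>UNIV. ?W i (Y (left_annihilation i g)))"
    by (simp add: bounded_clinear_on_add[OF Y t] complex_vector.subspace_sum[OF M'] W'
        bounded_clinear_on_sum[OF Y M'] WY L)
  finally have eq: "tensor vacuum h = \<dots>" .
  have "ell2_apply (Y (tensor vacuum (ell2_apply g []))) [] = h"
    using arg_cong[OF eq, of "\<lambda>f. ell2_apply f []"]
    by (simp add: ell2_apply_sum vacuum_component_ampliation[OF H vac] bounded_clinear_on_in[OF Y L]
        tensor_apply vacuum_apply)
  then show ?thesis by (simp add: g_def)
qed

lemma similar_ampliations_imp_isomorphic:
  fixes J :: "('n::finite fock \<Rightarrow> 'n fock) set" and H :: "'a::chilbert_space set" and H' :: "'b::chilbert_space set"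
  assumes J: "wot_closed_ideal J" and vac: "vacuum \<in> N_space J"
    and H: "hilbert_subspace H" and H': "hilbert_subspace H'"
    and sim: "similar_tuples
      (tensor_space (N_space J) H) (\<lambda>i. ampliation (N_space J) H (B_shift J i))
      (tensor_space (N_space J) H') (\<lambda>i. ampliation (N_space J) H' (B_shift J i))"
  obtains A B where "bounded_clinear_on H H' A" "bounded_clinear_on H' H B"
    "\<And>x. x \<in> H \<Longrightarrow> B (A x) = x" "\<And>y. y \<in> H' \<Longrightarrow> A (B y) = y"
proof -
  let ?M = "tensor_space (N_space J) H" and ?M' = "tensor_space (N_space J) H'"
  let ?W = "\<lambda>i. ampliation (N_space J) H (B_shift J i)" and ?W' = "\<lambda>i. ampliation (N_space J) H' (B_shift J i)"
  obtain X Y where X: "bounded_clinear_on ?M ?M' X" and Y: "bounded_clinear_on ?M' ?M Y"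
    and YX: "\<And>x. x \<in> ?M \<Longrightarrow> Y (X x) = x" and XY: "\<And>y. y \<in> ?M' \<Longrightarrow> X (Y y) = y"
    and WX: "\<And>i x. x \<in> ?M \<Longrightarrow> X (?W i x) = ?W' i (X x)"
    using similar_tuplesE[OF sim] by metis
  have WY: "Y (?W' i y) = ?W i (Y y)" if "y \<in> ?M'" for i y
  proof -
    have y: "Y y \<in> ?M" by (rule bounded_clinear_on_in[OF Y that])
    have "?W' i y = X (?W i (Y y))" by (simp add: WX y XY that)
    then show ?thesis by (simp add: YX ampliation_in y)
  qed
  have emb: "bounded_clinear_on L (tensor_space (N_space J) L) (tensor vacuum)" for L :: "'c::chilbert_space set"
    by (rule bounded_clinear_on_mono[OF bounded_clinear_on_tensor]) (auto intro: tensor_in_tensor_space vac)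
  have comp: "bounded_clinear_on (tensor_space (N_space J) L) L (\<lambda>f. ell2_apply f [])"
    if "hilbert_subspace L" for L :: "'c::chilbert_space set"
    by (rule bounded_clinear_on_mono[OF bounded_clinear_on_ell2_apply]) (auto intro: tensor_space_values[OF that])
  show ?thesis
    by (rule that[OF bounded_clinear_on_compose[OF bounded_clinear_on_compose[OF emb X] comp[OF H']]
          bounded_clinear_on_compose[OF bounded_clinear_on_compose[OF emb Y] comp[OF H]]])
       (simp_all add: similar_ampliations_cancel[OF J vac H H' X Y YX WY]
          similar_ampliations_cancel[OF J vac H' H Y X XY WX])
qed

section \<open>Operators acting on the coefficients\<close>

text \<open>For bounded T this is I \<otimes> T.\<close>

definition ell2_map :: "('a::chilbert_space \<Rightarrow> 'b::chilbert_space) \<Rightarrow> ('i, 'a) ell2 \<Rightarrow> ('i, 'b) ell2" where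
  "ell2_map T f = Abs_ell2 (\<lambda>w. T (ell2_apply f w))"

lemma
  assumes T: "bounded_clinear_on UNIV N T"
  shows ell2_map_apply: "ell2_apply (ell2_map T f) w = T (ell2_apply f w)"
    and bounded_clinear_on_ell2_map: "bounded_clinear_on UNIV UNIV (ell2_map T :: ('i, _) ell2 \<Rightarrow> _)"
proof -
  obtain C where C: "C > 0" "\<And>x. norm (T x) \<le> C * norm x"
    using bounded_clinear_on_bound[OF T] by auto
  have bd: "(\<Sum>w\<in>F. (norm (T (ell2_apply f w)))\<^sup>2) \<le> (C * norm f)\<^sup>2" if "finite F"
    for F and f :: "('k, 'a) ell2"
  proof -
    have "(\<Sum>w\<in>F. (norm (T (ell2_apply f w)))\<^sup>2) \<le> (\<Sum>w\<in>F. (C * norm (ell2_apply f w))\<^sup>2)"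
      by (intro sum_mono power_mono C norm_ge_zero)
    also have "\<dots> \<le> (C * norm f)\<^sup>2"
      using sum_le_norm_ell2[OF that, of f]
      by (simp add: power_mult_distrib sum_distrib_left[symmetric] mult_left_mono)
    finally show ?thesis .
  qed
  have *: "(\<lambda>w. (norm (T (ell2_apply f w)))\<^sup>2) summable_on UNIV" "norm (ell2_map T f) \<le> C * norm f"
    for f :: "('k, 'a) ell2"
    unfolding ell2_map_def using ell2_boundedI[OF bd] C(1) by auto
  have app: "ell2_apply (ell2_map T f) w = T (ell2_apply f w)" for f :: "('k, 'a) ell2" and w
    unfolding ell2_map_def by (subst Abs_ell2_inverse) (use *(1) in auto)
  show "ell2_apply (ell2_map T f) w = T (ell2_apply f w)" by (rule app)
  show "bounded_clinear_on UNIV UNIV (ell2_map T :: ('i, _) ell2 \<Rightarrow> _)"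
    by (rule bounded_clinear_onI[where C = C])
       (auto intro!: ell2_eqI *(2) simp: app bounded_clinear_on_add[OF T] bounded_clinear_on_scaleC[OF T])
qed

lemma ell2_map_tensor:
  assumes "bounded_clinear_on UNIV N T"
  shows "ell2_map T (tensor \<phi> h) = tensor \<phi> (T h)"
  by (rule ell2_eqI) (simp add: ell2_map_apply[OF assms] tensor_apply bounded_clinear_on_scaleC[OF assms])

lemma ell2_map_tensor_space:
  assumes T: "bounded_clinear_on UNIV H' T" and f: "f \<in> tensor_space N H"
  shows "ell2_map T f \<in> tensor_space N H'"
  by (rule bounded_clinear_on_closure_cspan_in[OF bounded_clinear_on_ell2_map[OF T]
        hilbert_subspace_tensor_space _ f[unfolded tensor_space_def]])
     (auto simp: ell2_map_tensor[OF T] intro!: tensor_in_tensor_space bounded_clinear_on_in[OF T])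

text \<open>I \<otimes> U acts on coefficients and B_i \<otimes> I on words, so they commute on
  elementary tensors and, by density, everywhere.\<close>

lemma ampliations_unitarily_equivalent:
  assumes H: "hilbert_subspace H" and H': "hilbert_subspace H'"
    and U: "bounded_clinear_on H H' U" "bij_betw U H H'"
    and iso: "\<And>x y. x \<in> H \<Longrightarrow> y \<in> H \<Longrightarrow> cinner (U x) (U y) = cinner x y"
  shows "unitarily_equivalent_tuples
    (tensor_space (N_space J) H) (\<lambda>i. ampliation (N_space J) H (B_shift J i))
    (tensor_space (N_space J) H') (\<lambda>i. ampliation (N_space J) H' (B_shift J i))"
proof -
  let ?M = "tensor_space (N_space J) H" and ?M' = "tensor_space (N_space J) H'"
  let ?W = "\<lambda>i. ampliation (N_space J) H (B_shift J i)" and ?W' = "\<lambda>i. ampliation (N_space J) H' (B_shift J i)"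
  have subH: "csubspace H" using H by (simp add: hilbert_subspace_def)
  \<comment> \<open>The identity as a one-element tuple: a device to obtain a bounded inverse of U
    from the elimination rule.\<close>
  have "unitarily_equivalent_tuples H (\<lambda>_::unit. id) H' (\<lambda>_. id)"
    using U iso unfolding unitarily_equivalent_tuples_def by auto
  from unitarily_equivalent_tuplesE[OF this subH]
  obtain U Y where U: "bounded_clinear_on H H' U" and Y: "bounded_clinear_on H' H Y"
    and YU: "\<And>x. x \<in> H \<Longrightarrow> Y (U x) = x" and UY: "\<And>y. y \<in> H' \<Longrightarrow> U (Y y) = y"
    and iso: "\<And>x y. x \<in> H \<Longrightarrow> y \<in> H \<Longrightarrow> cinner (U x) (U y) = cinner x y"
    by metis
  \<comment> \<open>Extension by the projection, since \<open>ell2_map\<close> acts with a map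
    defined on the whole type.\<close>
  define u where "u = (\<lambda>x. U (orth_proj H x))"
  define y where "y = (\<lambda>x. Y (orth_proj H' x))"
  have u: "bounded_clinear_on UNIV H' u" and y: "bounded_clinear_on UNIV H y"
    unfolding u_def y_def
    using bounded_clinear_on_compose[OF bounded_clinear_on_orth_proj[OF H] U]
      bounded_clinear_on_compose[OF bounded_clinear_on_orth_proj[OF H'] Y] by auto
  have uU: "u x = U x" if "x \<in> H" for x using that by (simp add: u_def orth_proj_id[OF H])
  have yY: "y x = Y x" if "x \<in> H'" for x using that by (simp add: y_def orth_proj_id[OF H'])
  have u_lin: "bounded_clinear_on ?M ?M' (ell2_map u)"
    by (rule bounded_clinear_on_mono[OF bounded_clinear_on_ell2_map[OF u]])
       (auto intro: ell2_map_tensor_space[OF u])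
  show ?thesis
  proof (rule unitarily_equivalent_tuplesI[OF u_lin, where Y = "ell2_map y"])
    show "ell2_map y g \<in> ?M" if "g \<in> ?M'" for g by (rule ell2_map_tensor_space[OF y that])
    show "ell2_map y (ell2_map u f) = f" if "f \<in> ?M" for f
      by (rule ell2_eqI) (simp add: ell2_map_apply[OF u] ell2_map_apply[OF y] uU yY tensor_space_values[OF H that] YU
          bounded_clinear_on_in[OF U])
    show "ell2_map u (ell2_map y f) = f" if "f \<in> ?M'" for f
      by (rule ell2_eqI) (simp add: ell2_map_apply[OF u] ell2_map_apply[OF y] uU yY tensor_space_values[OF H' that] UY
          bounded_clinear_on_in[OF Y])
    show "cinner (ell2_map u f) (ell2_map u g) = cinner f g" if "f \<in> ?M" "g \<in> ?M" for f g
      unfolding cinner_ell2_def by (simp add: ell2_map_apply[OF u] uU tensor_space_values[OF H that(1)]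
          tensor_space_values[OF H that(2)] iso)
    show "ell2_map u (?W i f) = ?W' i (ell2_map u f)" if "f \<in> ?M" for i f
    proof (rule bounded_clinear_on_closure_cspan_eq[where S = "\<lambda>f. ell2_map u (?W i f)",
          OF bounded_clinear_on_compose[OF bounded_clinear_on_ampliation u_lin, unfolded tensor_space_def[of _ H]]
             bounded_clinear_on_compose[OF u_lin bounded_clinear_on_ampliation, unfolded tensor_space_def[of _ H]]
             _ that[unfolded tensor_space_def]])
      fix x assume "x \<in> {tensor \<phi> h | \<phi> h. \<phi> \<in> N_space J \<and> h \<in> H}"
      then obtain \<phi> h where x: "x = tensor \<phi> h" "\<phi> \<in> N_space J" "h \<in> H" by blast
      then show "ell2_map u (?W i x) = ?W' i (ell2_map u x)"
        by (simp add: ampliation_tensor ell2_map_tensor[OF u] bounded_clinear_on_in[OF u])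
    qed
  qed
qed

section \<open>Reduction of general shifts to the models on N \<otimes> H\<close>

theorem proposition1p11:
  fixes J :: "('n::finite fock \<Rightarrow> 'n fock) set"
    and H :: "'h::chilbert_space set" and K :: "'k::chilbert_space set" and V :: "'n \<Rightarrow> 'k \<Rightarrow> 'k"
    and H' :: "'h2::chilbert_space set" and K' :: "'k2::chilbert_space set" and V' :: "'n \<Rightarrow> 'k2 \<Rightarrow> 'k2"
  assumes "wot_closed_ideal J"
    and "vacuum \<in> N_space J"
    and "constrained_shift J H K V"
    and "constrained_shift J H' K' V'"
  shows "similar_tuples K V K' V' \<longleftrightarrow> unitarily_equivalent_tuples K V K' V'"
proof -
  let ?M = "tensor_space (N_space J) H" and ?M' = "tensor_space (N_space J) H'"
  let ?W = "\<lambda>i. ampliation (N_space J) H (B_shift J i)" and ?W' = "\<lambda>i. ampliation (N_space J) H' (B_shift J i)"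
  have H: "hilbert_subspace H" and H': "hilbert_subspace H'"
    and K: "csubspace K" and K': "csubspace K'" and M: "csubspace ?M" and M': "csubspace ?M'"
    and MK: "unitarily_equivalent_tuples ?M ?W K V" and MK': "unitarily_equivalent_tuples ?M' ?W' K' V'"
    using assms(3,4) hilbert_subspace_tensor_space
    by (auto simp: constrained_shift_def hilbert_subspace_def)
  show ?thesis
  proof
    assume sim: "similar_tuples K V K' V'"
    have "similar_tuples K' V' ?M' ?W'"
      by (rule similar_tuples_sym[OF unitarily_equivalent_imp_similar[OF MK' M' K'] M' ampliation_in])
    from similar_tuples_trans[OF similar_tuples_trans[OF unitarily_equivalent_imp_similar[OF MK M K] sim K'] this M']
    have "similar_tuples ?M ?W ?M' ?W'" .
    \<comment> \<open>From here on the similarity is discarded: the isomorphism of H and H' alone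
      yields the unitary equivalence.\<close>
    then obtain A B where "bounded_clinear_on H H' A" "bounded_clinear_on H' H B"
      "\<And>x. x \<in> H \<Longrightarrow> B (A x) = x" "\<And>y. y \<in> H' \<Longrightarrow> A (B y) = y"
      using similar_ampliations_imp_isomorphic[OF assms(1,2) H H'] by metis
    then obtain U where "bounded_clinear_on H H' U" "bij_betw U H H'"
      "\<And>x y. x \<in> H \<Longrightarrow> y \<in> H \<Longrightarrow> cinner (U x) (U y) = cinner x y"
      using isometry_of_isomorphism[OF H] by metis
    then have "unitarily_equivalent_tuples ?M ?W ?M' ?W'"
      by (rule ampliations_unitarily_equivalent[OF H H'])
    from unitarily_equivalent_tuples_trans[OF this MK' M M']
    show "unitarily_equivalent_tuples K V K' V'"
      by (rule unitarily_equivalent_tuples_trans[OF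
            unitarily_equivalent_tuples_sym[OF MK M ampliation_in] _ K M, rotated])
  next
    assume "unitarily_equivalent_tuples K V K' V'"
    then show "similar_tuples K V K' V'" by (rule unitarily_equivalent_imp_similar[OF _ K K'])
  qed
qed

end
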